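(* Let $(F,u_0)$ be a pointed covering space over a pointed type $(X,x_0)$. A pointed map $f : (Y,y_0)\to_*(X,x_0)$, with $Y$ a connected type, can be lifted to a pointed lift $\widetilde f : \prod_{y:Y}F(f(y))$ if and only if for all loops $p : y_0 =_Y y_0$ there exists a dependent loop $$\mathsf{transport}^F(f_*(p),u_0) =_{F(x_0)} u_0,$$ meaning that there exists a loop from $u_0$ to $u_0$ over $f_*(p)$ in $F$.
   Context: We work in homotopy type theory (Martin-Löf type theory with a univalent universe $\mathsf{Type}$, function extensionality and higher inductive types). $\mathsf{Set}$ is the type of 0-types and $\|A\|$ is propositional truncation. For a type family $P : X\to\mathsf{Type}$, $p : a =_X b$ and $u:P(a)$, $\mathsf{transport}^P(p,u) : P(b)$ is transport; path concatenation is written $p\cdot q$ in diagrammatic order. A type $Y$ is connected if it is path-connected: $\|a =_Y b\|$ is inhabited for all $a,b:Y$. A pointed covering space over $(X,x_0)$ is a pair $(F,u_0)$ with $F : X \to \mathsf{Set}$ and $u_0:F(x_0)$. A pointed map $f : (Y,y_0)\to_*(X,x_0)$ is a map $f:Y\to X$ with a path $w_f : f(y_0) =_X x_0$. A pointed lift of $f$ to $(F,u_0)$ is a dependent map $\widetilde f : \prod_{y:Y}F(f(y))$ such that $\mathsf{transport}^F(w_f,\widetilde f(y_0)) =_{F(x_0)} u_0$. For a loop $p : y_0 =_Y y_0$, $f_*(p) := w_f^{-1}\cdot\mathsf{ap}_f(p)\cdot w_f : x_0 =_X x_0$. *)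

theory Defs
  imports Main
begin

text \<open>
  A deep embedding of homotopy type theory, presented as a typed lambda calculus with dependent
  products and a countable hierarchy of universes, all other type formers being constants with
  closed types and judgmental computation rules.  A shallow embedding, in which object-level
  functions are HOL functions, is ruled out: with the choice operator of HOL it would contradict
  univalence.
\<close>

section \<open>Raw syntax\<close>

text \<open>
  The hierarchy is not cumulative, so constants carry the levels of the types they act on and
  every term has a unique type up to judgmental equality.
\<close>

datatype const =
    CSig nat nat | CPair nat nat | CSigInd nat nat nat
  | CSum nat nat | CInl nat nat | CInr nat nat | CSumInd nat nat nat
  | CEmpty nat | CEmptyInd nat nat
  | CUnit nat | CStar nat | CUnitInd nat nat
  | CNat | CZero | CSucc | CNatInd nat
  | CId nat | CRefl nat | CIdInd nat nat
  | CTrunc nat | CIn nat | CSquash nat | CTruncInd nat nat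
  | CFunext nat nat | CUnivalence nat

datatype tm =
    Var nat  \<comment> \<open>de Bruijn index\<close>
  | Univ nat
  | Con const
  | Pi tm tm
  | Lam tm tm
  | App tm tm  (infixl "\<degree>" 100)

fun lift :: "nat \<Rightarrow> tm \<Rightarrow> tm" where
  "lift k (Var n) = Var (if n < k then n else Suc n)"
| "lift k (Univ i) = Univ i"
| "lift k (Con c) = Con c"
| "lift k (Pi A B) = Pi (lift k A) (lift (Suc k) B)"
| "lift k (Lam A b) = Lam (lift k A) (lift (Suc k) b)"
| "lift k (f \<degree> a) = lift k f \<degree> lift k a"

text \<open>\<open>subst k s t\<close> replaces index \<open>k\<close> by \<open>s\<close> in \<open>t\<close> and lowers the indices above \<open>k\<close>.\<close>

fun subst :: "nat \<Rightarrow> tm \<Rightarrow> tm \<Rightarrow> tm" where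
  "subst k s (Var n) = (if n < k then Var n else if n = k then s else Var (n - 1))"
| "subst k s (Univ i) = Univ i"
| "subst k s (Con c) = Con c"
| "subst k s (Pi A B) = Pi (subst k s A) (subst (Suc k) (lift 0 s) B)"
| "subst k s (Lam A b) = Lam (subst k s A) (subst (Suc k) (lift 0 s) b)"
| "subst k s (f \<degree> a) = subst k s f \<degree> subst k s a"


section \<open>Named notation for terms\<close>

text \<open>
  To write concrete terms with named variables, a term is represented by the function that maps a
  depth (the number of binders passed) to the de Bruijn term it denotes at that depth.  The
  variable bound at depth \<open>n\<close> has index \<open>m - Suc n\<close> when it is used at depth \<open>m\<close>.
\<close>

type_synonym pre = "nat \<Rightarrow> tm"

definition bvar :: "nat \<Rightarrow> pre" where
  "bvar n = (\<lambda>m. Var (m - Suc n))"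

definition PI :: "pre \<Rightarrow> (pre \<Rightarrow> pre) \<Rightarrow> pre" where
  "PI A B = (\<lambda>n. Pi (A n) (B (bvar n) (Suc n)))"

definition LAM :: "pre \<Rightarrow> (pre \<Rightarrow> pre) \<Rightarrow> pre" where
  "LAM A b = (\<lambda>n. Lam (A n) (b (bvar n) (Suc n)))"

definition app :: "pre \<Rightarrow> pre \<Rightarrow> pre"  (infixl "\<cdot>" 100) where
  "f \<cdot> a = (\<lambda>n. f n \<degree> a n)"

definition univ :: "nat \<Rightarrow> pre"  ("\<U>") where
  "\<U> i = (\<lambda>n. Univ i)"

definition con :: "const \<Rightarrow> pre" where
  "con c = (\<lambda>n. Con c)"

text \<open>The term denoted by a closed expression, and the same term used at any depth.\<close>

definition close :: "pre \<Rightarrow> tm" where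
  "close e = e 0"

definition closed :: "pre \<Rightarrow> pre" where
  "closed e = (\<lambda>n. close e)"

syntax
  "_PI" :: "pttrn \<Rightarrow> pre \<Rightarrow> pre \<Rightarrow> pre"  ("(3\<Pi> _\<in>_./ _)" [0, 61, 10] 10)
  "_LAM" :: "pttrn \<Rightarrow> pre \<Rightarrow> pre \<Rightarrow> pre"  ("(3\<Lambda> _\<in>_./ _)" [0, 61, 10] 10)
translations
  "\<Pi> x\<in>A. B" \<rightleftharpoons> "CONST PI A (\<lambda>x. B)"
  "\<Lambda> x\<in>A. b" \<rightleftharpoons> "CONST LAM A (\<lambda>x. b)"

abbreviation Fun :: "pre \<Rightarrow> pre \<Rightarrow> pre"  (infixr "\<rightarrow>" 62) where
  "A \<rightarrow> B \<equiv> PI A (\<lambda>_. B)"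

abbreviation SIG :: "nat \<Rightarrow> nat \<Rightarrow> pre \<Rightarrow> (pre \<Rightarrow> pre) \<Rightarrow> pre" where
  "SIG i j A B \<equiv> con (CSig i j) \<cdot> A \<cdot> LAM A B"

syntax
  "_SIG" :: "nat \<Rightarrow> nat \<Rightarrow> pttrn \<Rightarrow> pre \<Rightarrow> pre \<Rightarrow> pre"
    ("(3\<Sigma>\<^bsub>_,_\<^esub> _\<in>_./ _)" [0, 0, 0, 61, 10] 10)
translations
  "\<Sigma>\<^bsub>i,j\<^esub> x\<in>A. B" \<rightleftharpoons> "CONST SIG i j A (\<lambda>x. B)"

abbreviation ProdT :: "nat \<Rightarrow> nat \<Rightarrow> pre \<Rightarrow> pre \<Rightarrow> pre" where
  "ProdT i j A B \<equiv> SIG i j A (\<lambda>_. B)"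

abbreviation pairT :: "nat \<Rightarrow> nat \<Rightarrow> pre \<Rightarrow> (pre \<Rightarrow> pre) \<Rightarrow> pre \<Rightarrow> pre \<Rightarrow> pre" where
  "pairT i j A B a b \<equiv> con (CPair i j) \<cdot> A \<cdot> LAM A B \<cdot> a \<cdot> b"

abbreviation IdT :: "nat \<Rightarrow> pre \<Rightarrow> pre \<Rightarrow> pre \<Rightarrow> pre" where
  "IdT i A a b \<equiv> con (CId i) \<cdot> A \<cdot> a \<cdot> b"

abbreviation reflT :: "nat \<Rightarrow> pre \<Rightarrow> pre \<Rightarrow> pre" where
  "reflT i A a \<equiv> con (CRefl i) \<cdot> A \<cdot> a"

abbreviation Trunc :: "nat \<Rightarrow> pre \<Rightarrow> pre" where
  "Trunc i A \<equiv> con (CTrunc i) \<cdot> A"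

text \<open>
  Path induction based at \<open>a\<close>: for \<open>C x q\<close> depending on \<open>x\<close> and \<open>q : a = x\<close>, and \<open>d\<close> in
  \<open>C a (reflT a)\<close>, an element of \<open>C b p\<close>.  The levels are those of \<open>A\<close> and \<open>C\<close>.
\<close>

abbreviation idind ::
    "nat \<Rightarrow> nat \<Rightarrow> pre \<Rightarrow> pre \<Rightarrow> (pre \<Rightarrow> pre \<Rightarrow> pre) \<Rightarrow> pre \<Rightarrow> pre \<Rightarrow> pre \<Rightarrow> pre" where
  "idind i j A a C d b p \<equiv>
     con (CIdInd i j) \<cdot> A \<cdot> a \<cdot> (\<Lambda> x\<in>A. \<Lambda> q\<in>IdT i A a x. C x q) \<cdot> d \<cdot> b \<cdot> p"


section \<open>Defined notions of homotopy type theory\<close>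

definition transport :: "nat \<Rightarrow> nat \<Rightarrow> pre" where
  "transport i j = closed (
     \<Lambda> A\<in>\<U> i. \<Lambda> P\<in>(A \<rightarrow> \<U> j). \<Lambda> a\<in>A. \<Lambda> b\<in>A. \<Lambda> p\<in>IdT i A a b. \<Lambda> u\<in>P \<cdot> a.
       idind i j A a (\<lambda>x q. P \<cdot> x) u b p)"

definition path_inverse :: "nat \<Rightarrow> pre" where
  "path_inverse i = closed (
     \<Lambda> A\<in>\<U> i. \<Lambda> a\<in>A. \<Lambda> b\<in>A. \<Lambda> p\<in>IdT i A a b.
       idind i i A a (\<lambda>x q. IdT i A x a) (reflT i A a) b p)"

definition path_concat :: "nat \<Rightarrow> pre" where
  "path_concat i = closed (
     \<Lambda> A\<in>\<U> i. \<Lambda> a\<in>A. \<Lambda> b\<in>A. \<Lambda> c\<in>A. \<Lambda> p\<in>IdT i A a b. \<Lambda> q\<in>IdT i A b c.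
       idind i i A b (\<lambda>x r. IdT i A a x) p c q)"

definition ap :: "nat \<Rightarrow> nat \<Rightarrow> pre" where
  "ap i j = closed (
     \<Lambda> A\<in>\<U> i. \<Lambda> B\<in>\<U> j. \<Lambda> f\<in>(A \<rightarrow> B). \<Lambda> a\<in>A. \<Lambda> b\<in>A. \<Lambda> p\<in>IdT i A a b.
       idind i j A a (\<lambda>x q. IdT j B (f \<cdot> a) (f \<cdot> x)) (reflT j B (f \<cdot> a)) b p)"

definition isProp :: "nat \<Rightarrow> pre" where
  "isProp i = closed (\<Lambda> A\<in>\<U> i. \<Pi> x\<in>A. \<Pi> y\<in>A. IdT i A x y)"

definition isSet :: "nat \<Rightarrow> pre" where
  "isSet i = closed (
     \<Lambda> A\<in>\<U> i. \<Pi> x\<in>A. \<Pi> y\<in>A. \<Pi> p\<in>IdT i A x y. \<Pi> q\<in>IdT i A x y. IdT i (IdT i A x y) p q)"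

definition SET :: "nat \<Rightarrow> pre" where
  "SET i = closed (\<Sigma>\<^bsub>Suc i,i\<^esub> A\<in>\<U> i. isSet i \<cdot> A)"

text \<open>The underlying type of a set: the first projection.\<close>

definition El :: "nat \<Rightarrow> pre" where
  "El i = closed (
     \<Lambda> S\<in>SET i.
       con (CSigInd (Suc i) i (Suc i)) \<cdot> \<U> i \<cdot> (\<Lambda> A\<in>\<U> i. isSet i \<cdot> A) \<cdot> (\<Lambda> _\<in>SET i. \<U> i)
         \<cdot> (\<Lambda> A\<in>\<U> i. \<Lambda> h\<in>isSet i \<cdot> A. A) \<cdot> S)"

definition isConnected :: "nat \<Rightarrow> pre" where
  "isConnected i = closed (\<Lambda> Y\<in>\<U> i. \<Pi> a\<in>Y. \<Pi> b\<in>Y. Trunc i (IdT i Y a b))"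

text \<open>Equivalences are the bi-invertible maps.\<close>

definition isEquiv :: "nat \<Rightarrow> nat \<Rightarrow> pre" where
  "isEquiv i j = closed (
     \<Lambda> A\<in>\<U> i. \<Lambda> B\<in>\<U> j. \<Lambda> f\<in>(A \<rightarrow> B).
       ProdT (max i j) (max i j)
         (\<Sigma>\<^bsub>max i j,j\<^esub> g\<in>(B \<rightarrow> A). \<Pi> y\<in>B. IdT j B (f \<cdot> (g \<cdot> y)) y)
         (\<Sigma>\<^bsub>max i j,i\<^esub> g\<in>(B \<rightarrow> A). \<Pi> x\<in>A. IdT i A (g \<cdot> (f \<cdot> x)) x))"

definition eqv :: "nat \<Rightarrow> pre" where
  "eqv i = closed (\<Lambda> A\<in>\<U> i. \<Lambda> B\<in>\<U> i. \<Sigma>\<^bsub>i,i\<^esub> f\<in>(A \<rightarrow> B). isEquiv i i \<cdot> A \<cdot> B \<cdot> f)"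

definition ideqv :: "nat \<Rightarrow> pre" where
  "ideqv i = closed (
     \<Lambda> A\<in>\<U> i.
       pairT i i (A \<rightarrow> A) (\<lambda>f. isEquiv i i \<cdot> A \<cdot> A \<cdot> f) (\<Lambda> x\<in>A. x)
         (pairT i i
            (\<Sigma>\<^bsub>i,i\<^esub> g\<in>(A \<rightarrow> A). \<Pi> y\<in>A. IdT i A ((\<Lambda> x\<in>A. x) \<cdot> (g \<cdot> y)) y)
            (\<lambda>_. \<Sigma>\<^bsub>i,i\<^esub> g\<in>(A \<rightarrow> A). \<Pi> x\<in>A. IdT i A (g \<cdot> ((\<Lambda> x\<in>A. x) \<cdot> x)) x)
            (pairT i i (A \<rightarrow> A) (\<lambda>g. \<Pi> y\<in>A. IdT i A ((\<Lambda> x\<in>A. x) \<cdot> (g \<cdot> y)) y)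
               (\<Lambda> x\<in>A. x) (\<Lambda> y\<in>A. reflT i A y))
            (pairT i i (A \<rightarrow> A) (\<lambda>g. \<Pi> x\<in>A. IdT i A (g \<cdot> ((\<Lambda> x\<in>A. x) \<cdot> x)) x)
               (\<Lambda> x\<in>A. x) (\<Lambda> x\<in>A. reflT i A x))))"

definition idtoeqv :: "nat \<Rightarrow> pre" where
  "idtoeqv i = closed (
     \<Lambda> A\<in>\<U> i. \<Lambda> B\<in>\<U> i. \<Lambda> p\<in>IdT (Suc i) (\<U> i) A B.
       idind (Suc i) i (\<U> i) A (\<lambda>X q. eqv i \<cdot> A \<cdot> X) (ideqv i \<cdot> A) B p)"

definition happly :: "nat \<Rightarrow> nat \<Rightarrow> pre" where
  "happly i j = closed (
     \<Lambda> A\<in>\<U> i. \<Lambda> B\<in>(A \<rightarrow> \<U> j). \<Lambda> f\<in>(\<Pi> x\<in>A. B \<cdot> x). \<Lambda> g\<in>(\<Pi> x\<in>A. B \<cdot> x).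
     \<Lambda> p\<in>IdT (max i j) (\<Pi> x\<in>A. B \<cdot> x) f g.
       idind (max i j) (max i j) (\<Pi> x\<in>A. B \<cdot> x) f
         (\<lambda>h q. \<Pi> x\<in>A. IdT j (B \<cdot> x) (f \<cdot> x) (h \<cdot> x)) (\<Lambda> x\<in>A. reflT j (B \<cdot> x) (f \<cdot> x)) g p)"


section \<open>Types of the constants\<close>

text \<open>
  The eliminator of the propositional truncation is stated for families of propositions; such a
  family is the same as one with a dependent path over each path given by the constructor
  \<open>CSquash\<close>, and the propositional computation rule for \<open>CSquash\<close> then holds automatically.
\<close>

fun ctype :: "const \<Rightarrow> pre" where
  "ctype (CSig i j) = (\<Pi> A\<in>\<U> i. \<Pi> B\<in>(A \<rightarrow> \<U> j). \<U> (max i j))"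
| "ctype (CPair i j) =
     (\<Pi> A\<in>\<U> i. \<Pi> B\<in>(A \<rightarrow> \<U> j). \<Pi> a\<in>A. \<Pi> b\<in>B \<cdot> a. con (CSig i j) \<cdot> A \<cdot> B)"
| "ctype (CSigInd i j k) =
     (\<Pi> A\<in>\<U> i. \<Pi> B\<in>(A \<rightarrow> \<U> j). \<Pi> C\<in>(con (CSig i j) \<cdot> A \<cdot> B \<rightarrow> \<U> k).
      \<Pi> g\<in>(\<Pi> a\<in>A. \<Pi> b\<in>B \<cdot> a. C \<cdot> (con (CPair i j) \<cdot> A \<cdot> B \<cdot> a \<cdot> b)).
      \<Pi> z\<in>con (CSig i j) \<cdot> A \<cdot> B. C \<cdot> z)"
| "ctype (CSum i j) = (\<Pi> A\<in>\<U> i. \<Pi> B\<in>\<U> j. \<U> (max i j))"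
| "ctype (CInl i j) = (\<Pi> A\<in>\<U> i. \<Pi> B\<in>\<U> j. \<Pi> a\<in>A. con (CSum i j) \<cdot> A \<cdot> B)"
| "ctype (CInr i j) = (\<Pi> A\<in>\<U> i. \<Pi> B\<in>\<U> j. \<Pi> b\<in>B. con (CSum i j) \<cdot> A \<cdot> B)"
| "ctype (CSumInd i j k) =
     (\<Pi> A\<in>\<U> i. \<Pi> B\<in>\<U> j. \<Pi> C\<in>(con (CSum i j) \<cdot> A \<cdot> B \<rightarrow> \<U> k).
      \<Pi> l\<in>(\<Pi> a\<in>A. C \<cdot> (con (CInl i j) \<cdot> A \<cdot> B \<cdot> a)).
      \<Pi> r\<in>(\<Pi> b\<in>B. C \<cdot> (con (CInr i j) \<cdot> A \<cdot> B \<cdot> b)).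
      \<Pi> z\<in>con (CSum i j) \<cdot> A \<cdot> B. C \<cdot> z)"
| "ctype (CEmpty i) = \<U> i"
| "ctype (CEmptyInd i k) = (\<Pi> C\<in>(con (CEmpty i) \<rightarrow> \<U> k). \<Pi> z\<in>con (CEmpty i). C \<cdot> z)"
| "ctype (CUnit i) = \<U> i"
| "ctype (CStar i) = con (CUnit i)"
| "ctype (CUnitInd i k) =
     (\<Pi> C\<in>(con (CUnit i) \<rightarrow> \<U> k). \<Pi> c\<in>C \<cdot> con (CStar i). \<Pi> z\<in>con (CUnit i). C \<cdot> z)"
| "ctype CNat = \<U> 0"
| "ctype CZero = con CNat"
| "ctype CSucc = (con CNat \<rightarrow> con CNat)"
| "ctype (CNatInd k) =
     (\<Pi> C\<in>(con CNat \<rightarrow> \<U> k). \<Pi> c\<in>C \<cdot> con CZero.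
      \<Pi> s\<in>(\<Pi> n\<in>con CNat. \<Pi> r\<in>C \<cdot> n. C \<cdot> (con CSucc \<cdot> n)). \<Pi> n\<in>con CNat. C \<cdot> n)"
| "ctype (CId i) = (\<Pi> A\<in>\<U> i. \<Pi> a\<in>A. \<Pi> b\<in>A. \<U> i)"
| "ctype (CRefl i) = (\<Pi> A\<in>\<U> i. \<Pi> a\<in>A. IdT i A a a)"
| "ctype (CIdInd i k) =
     (\<Pi> A\<in>\<U> i. \<Pi> a\<in>A. \<Pi> C\<in>(\<Pi> x\<in>A. \<Pi> q\<in>IdT i A a x. \<U> k).
      \<Pi> d\<in>C \<cdot> a \<cdot> reflT i A a. \<Pi> b\<in>A. \<Pi> p\<in>IdT i A a b. C \<cdot> b \<cdot> p)"
| "ctype (CTrunc i) = (\<Pi> A\<in>\<U> i. \<U> i)"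
| "ctype (CIn i) = (\<Pi> A\<in>\<U> i. \<Pi> a\<in>A. Trunc i A)"
| "ctype (CSquash i) = (\<Pi> A\<in>\<U> i. \<Pi> x\<in>Trunc i A. \<Pi> y\<in>Trunc i A. IdT i (Trunc i A) x y)"
| "ctype (CTruncInd i k) =
     (\<Pi> A\<in>\<U> i. \<Pi> C\<in>(Trunc i A \<rightarrow> \<U> k). \<Pi> h\<in>(\<Pi> z\<in>Trunc i A. isProp k \<cdot> (C \<cdot> z)).
      \<Pi> g\<in>(\<Pi> a\<in>A. C \<cdot> (con (CIn i) \<cdot> A \<cdot> a)). \<Pi> z\<in>Trunc i A. C \<cdot> z)"
| "ctype (CFunext i j) =
     (\<Pi> A\<in>\<U> i. \<Pi> B\<in>(A \<rightarrow> \<U> j). \<Pi> f\<in>(\<Pi> x\<in>A. B \<cdot> x). \<Pi> g\<in>(\<Pi> x\<in>A. B \<cdot> x).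
      isEquiv (max i j) (max i j) \<cdot> IdT (max i j) (\<Pi> x\<in>A. B \<cdot> x) f g
        \<cdot> (\<Pi> x\<in>A. IdT j (B \<cdot> x) (f \<cdot> x) (g \<cdot> x)) \<cdot> (happly i j \<cdot> A \<cdot> B \<cdot> f \<cdot> g))"
| "ctype (CUnivalence i) =
     (\<Pi> A\<in>\<U> i. \<Pi> B\<in>\<U> i.
      isEquiv (Suc i) i \<cdot> IdT (Suc i) (\<U> i) A B \<cdot> (eqv i \<cdot> A \<cdot> B) \<cdot> (idtoeqv i \<cdot> A \<cdot> B))"


section \<open>Judgments\<close>

inductive comp :: "tm \<Rightarrow> tm \<Rightarrow> bool" where
  comp_Sig: "comp (Con (CSigInd i j k) \<degree> A \<degree> B \<degree> C \<degree> g \<degree> (Con (CPair i j) \<degree> A \<degree> B \<degree> a \<degree> b))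
                  (g \<degree> a \<degree> b)"
| comp_Inl: "comp (Con (CSumInd i j k) \<degree> A \<degree> B \<degree> C \<degree> l \<degree> r \<degree> (Con (CInl i j) \<degree> A \<degree> B \<degree> a)) (l \<degree> a)"
| comp_Inr: "comp (Con (CSumInd i j k) \<degree> A \<degree> B \<degree> C \<degree> l \<degree> r \<degree> (Con (CInr i j) \<degree> A \<degree> B \<degree> b)) (r \<degree> b)"
| comp_Unit: "comp (Con (CUnitInd i k) \<degree> C \<degree> c \<degree> Con (CStar i)) c"
| comp_Zero: "comp (Con (CNatInd k) \<degree> C \<degree> c \<degree> s \<degree> Con CZero) c"
| comp_Succ: "comp (Con (CNatInd k) \<degree> C \<degree> c \<degree> s \<degree> (Con CSucc \<degree> n))
                   (s \<degree> n \<degree> (Con (CNatInd k) \<degree> C \<degree> c \<degree> s \<degree> n))"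
| comp_Id: "comp (Con (CIdInd i k) \<degree> A \<degree> a \<degree> C \<degree> d \<degree> a \<degree> (Con (CRefl i) \<degree> A \<degree> a)) d"
| comp_Trunc: "comp (Con (CTruncInd i k) \<degree> A \<degree> C \<degree> h \<degree> g \<degree> (Con (CIn i) \<degree> A \<degree> a)) (g \<degree> a)"

text \<open>Contexts list the innermost variable first; entry \<open>n\<close> lives in the context after it.\<close>

inductive
  ctx :: "tm list \<Rightarrow> bool"  ("_ ctx" [50] 50) and
  typing :: "tm list \<Rightarrow> tm \<Rightarrow> tm \<Rightarrow> bool"  ("_ \<turnstile> _ : _" [50, 50, 50] 50) and
  jeq :: "tm list \<Rightarrow> tm \<Rightarrow> tm \<Rightarrow> tm \<Rightarrow> bool"  ("_ \<turnstile> _ \<equiv> _ : _" [50, 50, 50, 50] 50)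
where
  ctx_Nil: "[] ctx"
| ctx_Cons: "\<Gamma> \<turnstile> A : Univ i \<Longrightarrow> (A # \<Gamma>) ctx"

| ty_Var: "\<lbrakk>\<Gamma> ctx; n < length \<Gamma>\<rbrakk> \<Longrightarrow> \<Gamma> \<turnstile> Var n : (lift 0 ^^ Suc n) (\<Gamma> ! n)"
| ty_Univ: "\<Gamma> ctx \<Longrightarrow> \<Gamma> \<turnstile> Univ i : Univ (Suc i)"
| ty_Con: "\<Gamma> ctx \<Longrightarrow> \<Gamma> \<turnstile> Con c : close (ctype c)"
| ty_Pi: "\<lbrakk>\<Gamma> \<turnstile> A : Univ i; A # \<Gamma> \<turnstile> B : Univ j\<rbrakk> \<Longrightarrow> \<Gamma> \<turnstile> Pi A B : Univ (max i j)"
| ty_Lam: "\<lbrakk>\<Gamma> \<turnstile> A : Univ i; A # \<Gamma> \<turnstile> b : B\<rbrakk> \<Longrightarrow> \<Gamma> \<turnstile> Lam A b : Pi A B"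
| ty_App: "\<lbrakk>\<Gamma> \<turnstile> f : Pi A B; \<Gamma> \<turnstile> a : A\<rbrakk> \<Longrightarrow> \<Gamma> \<turnstile> f \<degree> a : subst 0 a B"
| ty_conv: "\<lbrakk>\<Gamma> \<turnstile> a : A; \<Gamma> \<turnstile> A \<equiv> B : Univ i\<rbrakk> \<Longrightarrow> \<Gamma> \<turnstile> a : B"

| eq_refl: "\<Gamma> \<turnstile> a : A \<Longrightarrow> \<Gamma> \<turnstile> a \<equiv> a : A"
| eq_sym: "\<Gamma> \<turnstile> a \<equiv> b : A \<Longrightarrow> \<Gamma> \<turnstile> b \<equiv> a : A"
| eq_trans: "\<lbrakk>\<Gamma> \<turnstile> a \<equiv> b : A; \<Gamma> \<turnstile> b \<equiv> c : A\<rbrakk> \<Longrightarrow> \<Gamma> \<turnstile> a \<equiv> c : A"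
| eq_conv: "\<lbrakk>\<Gamma> \<turnstile> a \<equiv> b : A; \<Gamma> \<turnstile> A \<equiv> B : Univ i\<rbrakk> \<Longrightarrow> \<Gamma> \<turnstile> a \<equiv> b : B"
| eq_Pi: "\<lbrakk>\<Gamma> \<turnstile> A : Univ i; \<Gamma> \<turnstile> A \<equiv> A' : Univ i; A # \<Gamma> \<turnstile> B \<equiv> B' : Univ j\<rbrakk>
    \<Longrightarrow> \<Gamma> \<turnstile> Pi A B \<equiv> Pi A' B' : Univ (max i j)"
| eq_Lam: "\<lbrakk>\<Gamma> \<turnstile> A : Univ i; \<Gamma> \<turnstile> A \<equiv> A' : Univ i; A # \<Gamma> \<turnstile> b \<equiv> b' : B\<rbrakk>
    \<Longrightarrow> \<Gamma> \<turnstile> Lam A b \<equiv> Lam A' b' : Pi A B"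
| eq_App: "\<lbrakk>\<Gamma> \<turnstile> f \<equiv> f' : Pi A B; \<Gamma> \<turnstile> a \<equiv> a' : A\<rbrakk> \<Longrightarrow> \<Gamma> \<turnstile> f \<degree> a \<equiv> f' \<degree> a' : subst 0 a B"
| eq_beta: "\<lbrakk>\<Gamma> \<turnstile> A : Univ i; A # \<Gamma> \<turnstile> b : B; \<Gamma> \<turnstile> a : A\<rbrakk>
    \<Longrightarrow> \<Gamma> \<turnstile> Lam A b \<degree> a \<equiv> subst 0 a b : subst 0 a B"
| eq_eta: "\<Gamma> \<turnstile> f : Pi A B \<Longrightarrow> \<Gamma> \<turnstile> f \<equiv> Lam A (lift 0 f \<degree> Var 0) : Pi A B"
| eq_comp: "\<lbrakk>comp s t; \<Gamma> \<turnstile> s : T; \<Gamma> \<turnstile> t : T\<rbrakk> \<Longrightarrow> \<Gamma> \<turnstile> s \<equiv> t : T"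

definition inhabited :: "pre \<Rightarrow> bool" where
  "inhabited T \<longleftrightarrow> (\<exists>t. [] \<turnstile> t : close T)"


section \<open>Covering spaces and lifts\<close>

definition iffT :: "nat \<Rightarrow> pre" where
  "iffT i = closed (\<Lambda> A\<in>\<U> i. \<Lambda> B\<in>\<U> i. ProdT i i (A \<rightarrow> B) (B \<rightarrow> A))"

text \<open>
  A covering space \<open>F : X \<rightarrow> SET\<close>, regarded as a type family; its fibre over \<open>x\<close> is
  \<open>fam i \<cdot> X \<cdot> F \<cdot> x\<close>.
\<close>

definition fam :: "nat \<Rightarrow> pre" where
  "fam i = closed (\<Lambda> X\<in>\<U> i. \<Lambda> F\<in>(X \<rightarrow> SET i). \<Lambda> x\<in>X. El i \<cdot> (F \<cdot> x))"

text \<open>The loop \<open>w\<^sup>-\<^sup>1 \<cdot> ap f p \<cdot> w\<close> at \<open>x\<^sub>0\<close>, for \<open>w : f y\<^sub>0 = x\<^sub>0\<close> and \<open>p : y\<^sub>0 = y\<^sub>0\<close>.\<close>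

definition loopmap :: "nat \<Rightarrow> pre" where
  "loopmap i = closed (
     \<Lambda> X\<in>\<U> i. \<Lambda> x\<^sub>0\<in>X. \<Lambda> Y\<in>\<U> i. \<Lambda> y\<^sub>0\<in>Y. \<Lambda> f\<in>(Y \<rightarrow> X). \<Lambda> w\<in>IdT i X (f \<cdot> y\<^sub>0) x\<^sub>0. \<Lambda> p\<in>IdT i Y y\<^sub>0 y\<^sub>0.
       path_concat i \<cdot> X \<cdot> x\<^sub>0 \<cdot> (f \<cdot> y\<^sub>0) \<cdot> x\<^sub>0
         \<cdot> (path_concat i \<cdot> X \<cdot> x\<^sub>0 \<cdot> (f \<cdot> y\<^sub>0) \<cdot> (f \<cdot> y\<^sub>0)
              \<cdot> (path_inverse i \<cdot> X \<cdot> (f \<cdot> y\<^sub>0) \<cdot> x\<^sub>0 \<cdot> w) \<cdot> (ap i i \<cdot> Y \<cdot> X \<cdot> f \<cdot> y\<^sub>0 \<cdot> y\<^sub>0 \<cdot> p))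
         \<cdot> w)"

definition PointedLift :: "nat \<Rightarrow> pre" where
  "PointedLift i = closed (
     \<Lambda> X\<in>\<U> i. \<Lambda> x\<^sub>0\<in>X. \<Lambda> F\<in>(X \<rightarrow> SET i). \<Lambda> u\<^sub>0\<in>fam i \<cdot> X \<cdot> F \<cdot> x\<^sub>0.
     \<Lambda> Y\<in>\<U> i. \<Lambda> y\<^sub>0\<in>Y. \<Lambda> f\<in>(Y \<rightarrow> X). \<Lambda> w\<in>IdT i X (f \<cdot> y\<^sub>0) x\<^sub>0.
       \<Sigma>\<^bsub>i,i\<^esub> l\<in>(\<Pi> y\<in>Y. fam i \<cdot> X \<cdot> F \<cdot> (f \<cdot> y)).
         IdT i (fam i \<cdot> X \<cdot> F \<cdot> x\<^sub>0)
           (transport i i \<cdot> X \<cdot> (fam i \<cdot> X \<cdot> F) \<cdot> (f \<cdot> y\<^sub>0) \<cdot> x\<^sub>0 \<cdot> w \<cdot> (l \<cdot> y\<^sub>0)) u\<^sub>0)"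

end

theory Submission
  imports Defs "HOL-Library.Monad_Syntax"
begin

text \<open>
  Write \<open>P : X \<rightarrow> \<U>\<close> for the family of sets underlying \<open>F\<close>.

  A lift \<open>l\<close> with \<open>w\<^sub>* (l y\<^sub>0) = u\<^sub>0\<close> forces every loop \<open>p\<close> at \<open>y\<^sub>0\<close> to fix \<open>u\<^sub>0\<close>.  By path induction one may take \<open>u\<^sub>0\<close> to be
  \<open>w\<^sub>* (l y\<^sub>0)\<close> and then \<open>w\<close> to be reflexivity; what remains is that transport along \<open>ap f p\<close> takes \<open>l y\<^sub>0\<close> to
  \<open>l y\<^sub>0\<close>, and for paths \<open>p : y\<^sub>0 = y\<close> with a free endpoint this says that \<open>l\<close> respects paths.

  For the converse let \<open>w\<close> again be reflexivity.  Transporting \<open>u\<^sub>0\<close> along \<open>ap f q\<close> gives a map \<open>G y\<close> from the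
  paths \<open>q : y\<^sub>0 = y\<close> to \<open>P (f y)\<close>.  If loops fix \<open>u\<^sub>0\<close>, then \<open>G y\<close> takes equal values at any two paths: by
  induction on one of them, the other one may be assumed to be a loop.  Connectedness only provides an element of
  the truncation of \<open>y\<^sub>0 = y\<close>, but a map with equal values into a set factors through the truncation.  Indeed its
  image, the type of all \<open>v\<close> for which some \<open>a\<close> with \<open>g a = v\<close> merely exists, is a proposition because equations
  between the elements of a set are; this is where the fibres have to be sets.  The value obtained for \<open>y\<close> is the value of the lift there.

  The lemmas \<open>lift_fixes_loops\<close>, \<open>paths_agree\<close>, \<open>image_isProp\<close>, \<open>value_of_weakly_constant\<close> and \<open>section_from_paths\<close>
  carry these steps.  Each of them states that a closed type of the object theory is inhabited, and gives an explicit
  proof term.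

  The remaining task is to derive the typing judgments of these terms.  This is done by a type checker,
  defined as a function on terms, proved sound for the judgments and run by rewriting.  Soundness would
  normally require subject reduction, hence injectivity of \<open>\<Pi>\<close>, hence a normalization or confluence proof.  It is
  avoided by maintaining a weaker invariant: the checker shows that the given term is typed and that it is
  judgmentally equal to its reduct, never that the reduct is typed.  A reduct that is to be reduced further is
  simply checked again.  To contract \<open>f a\<close> when \<open>f\<close> has been reduced to an abstraction, it suffices to know that
  the body of the abstraction equals \<open>f\<close> applied to a variable.  With this invariant, weakening and
  substitution are all the metatheory that is needed.
\<close>

section \<open>Lifting and substitution of raw terms\<close>

lemma lift_lift: "i \<le> k \<Longrightarrow> lift i (lift k t) = lift (Suc k) (lift i t)"
  by (induction t arbitrary: i k) auto

lemma subst_lift_cancel [simp]: "subst k s (lift k t) = t"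
  by (induction t arbitrary: k s) auto

lemma lift_subst_above: "k \<le> m \<Longrightarrow> lift k (subst m s t) = subst (Suc m) (lift k s) (lift k t)"
  by (induction t arbitrary: k m s) (auto simp: lift_lift)

lemma lift_subst_below: "m \<le> k \<Longrightarrow> lift k (subst m s t) = subst m (lift k s) (lift (Suc k) t)"
  by (induction t arbitrary: k m s) (auto simp: lift_lift)

lemma subst_subst:
  "i \<le> j \<Longrightarrow> subst j s (subst i u t) = subst i (subst j s u) (subst (Suc j) (lift i s) t)"
proof (induction t arbitrary: i j s u)
  case (Pi A B)
  then show ?case using lift_subst_above[of 0 j s u] by (simp add: lift_lift)
next
  case (Lam A b)
  then show ?case using lift_subst_above[of 0 j s u] by (simp add: lift_lift)
qed auto

lemma lift_liftn_above: "m \<le> k \<Longrightarrow> lift k ((lift 0 ^^ m) t) = (lift 0 ^^ m) (lift (k - m) t)"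
proof (induction m arbitrary: k)
  case (Suc m)
  then obtain k' where k: "k = Suc k'" by (cases k) auto
  with Suc show ?case using lift_lift[of 0 k' "(lift 0 ^^ m) t"] by simp
qed simp

lemma lift_liftn_below: "k \<le> m \<Longrightarrow> lift k ((lift 0 ^^ m) t) = (lift 0 ^^ Suc m) t"
proof (induction m arbitrary: k)
  case (Suc m)
  show ?case
  proof (cases k)
    case (Suc k')
    then show ?thesis using Suc.IH[of k'] Suc.prems lift_lift[of 0 k' "(lift 0 ^^ m) t"] by simp
  qed simp
qed simp

lemma subst_liftn_above:
  "m \<le> k \<Longrightarrow> subst k ((lift 0 ^^ k) s) ((lift 0 ^^ m) t)
     = (lift 0 ^^ m) (subst (k - m) ((lift 0 ^^ (k - m)) s) t)"
proof (induction m arbitrary: k)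
  case (Suc m)
  then obtain k' where k: "k = Suc k'" by (cases k) auto
  with Suc show ?case
    using lift_subst_above[of 0 k' "(lift 0 ^^ k') s" "(lift 0 ^^ m) t"] by simp
qed simp

lemma subst_liftn_below: "k \<le> m \<Longrightarrow> subst k s ((lift 0 ^^ Suc m) t) = (lift 0 ^^ m) t"
  using lift_liftn_below[of k m t] subst_lift_cancel by metis

section \<open>Weakening and substitution of judgments\<close>

lemmas unfold_pre = PI_def LAM_def app_def con_def univ_def bvar_def close_def closed_def
  transport_def path_inverse_def path_concat_def ap_def isProp_def isSet_def SET_def El_def
  isConnected_def isEquiv_def eqv_def ideqv_def idtoeqv_def happly_def iffT_def fam_def
  loopmap_def PointedLift_def

text \<open>
  The types of the constants are closed: this is what makes the rule for constants stable under
  weakening and substitution.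
\<close>

lemma lift_ctype [simp]: "lift k (close (ctype c)) = close (ctype c)"
  by (cases c) (simp_all add: unfold_pre)

lemma subst_ctype [simp]: "subst k s (close (ctype c)) = close (ctype c)"
  using subst_lift_cancel[of k s "close (ctype c)"] by simp

lemma comp_lift: "comp s t \<Longrightarrow> comp (lift k s) (lift k t)"
  by (induction rule: comp.induct) (auto intro: comp.intros)

lemma comp_subst: "comp s t \<Longrightarrow> comp (subst k u s) (subst k u t)"
  by (induction rule: comp.induct) (auto intro: comp.intros)

lemma judgment_ctx:
  "\<Gamma> ctx \<Longrightarrow> \<Gamma> ctx" "\<Gamma> \<turnstile> t : T \<Longrightarrow> \<Gamma> ctx" "\<Gamma> \<turnstile> s \<equiv> t : T \<Longrightarrow> \<Gamma> ctx"
  by (induction rule: ctx_typing_jeq.inducts) (auto intro: ctx_typing_jeq.intros)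

text \<open>Lifting of a context prefix past a hypothesis inserted at its end, entry by entry.\<close>

fun lift_ctx :: "tm list \<Rightarrow> tm list" where
  "lift_ctx [] = []"
| "lift_ctx (A # \<Delta>) = lift (length \<Delta>) A # lift_ctx \<Delta>"

lemma length_lift_ctx [simp]: "length (lift_ctx \<Delta>) = length \<Delta>"
  by (induction \<Delta>) auto

lemma nth_lift_ctx: "n < length \<Delta> \<Longrightarrow> lift_ctx \<Delta> ! n = lift (length \<Delta> - Suc n) (\<Delta> ! n)"
  by (induction \<Delta> arbitrary: n) (auto simp: nth_Cons split: nat.splits)

text \<open>
  Inserting a hypothesis in the middle of a context.  The insertion point must be arbitrary because
  the rules for binders extend the context on the left.
\<close>

lemma weakening_at:
  assumes B: "\<Gamma> \<turnstile> B : Univ i"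
  shows "\<Gamma>' ctx \<Longrightarrow> (\<And>\<Delta>. \<Gamma>' = \<Delta> @ \<Gamma> \<Longrightarrow> lift_ctx \<Delta> @ B # \<Gamma> ctx)"
    and "\<Gamma>' \<turnstile> t : T \<Longrightarrow> (\<And>\<Delta>. \<Gamma>' = \<Delta> @ \<Gamma> \<Longrightarrow>
           lift_ctx \<Delta> @ B # \<Gamma> \<turnstile> lift (length \<Delta>) t : lift (length \<Delta>) T)"
    and "\<Gamma>' \<turnstile> s \<equiv> t : T \<Longrightarrow> (\<And>\<Delta>. \<Gamma>' = \<Delta> @ \<Gamma> \<Longrightarrow>
           lift_ctx \<Delta> @ B # \<Gamma> \<turnstile> lift (length \<Delta>) s \<equiv> lift (length \<Delta>) t : lift (length \<Delta>) T)"
proof (induction rule: ctx_typing_jeq.inducts)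
  case ctx_Nil
  then show ?case using B by (auto intro: ctx_Cons)
next
  case (ctx_Cons \<Gamma>' A i)
  then show ?case using B
    by (cases \<Delta>) (fastforce intro: ctx_typing_jeq.ctx_Cons)+
next
  case (ty_Var \<Gamma>' n)
  then have c: "lift_ctx \<Delta> @ B # \<Gamma> ctx" by blast
  show ?case
  proof (cases "n < length \<Delta>")
    case True
    then have "lift (length \<Delta>) ((lift 0 ^^ Suc n) (\<Gamma>' ! n)) = (lift 0 ^^ Suc n) ((lift_ctx \<Delta> @ B # \<Gamma>) ! n)"
      using ty_Var lift_liftn_above[of "Suc n" "length \<Delta>"]
      by (simp add: nth_append nth_lift_ctx del: funpow.simps)
    moreover have "lift_ctx \<Delta> @ B # \<Gamma> \<turnstile> Var n : (lift 0 ^^ Suc n) ((lift_ctx \<Delta> @ B # \<Gamma>) ! n)"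
      using c True by (intro ctx_typing_jeq.ty_Var) auto
    ultimately show ?thesis using True by simp
  next
    case False
    then have "lift (length \<Delta>) ((lift 0 ^^ Suc n) (\<Gamma>' ! n)) = (lift 0 ^^ Suc (Suc n)) ((lift_ctx \<Delta> @ B # \<Gamma>) ! Suc n)"
      using ty_Var lift_liftn_below[of "length \<Delta>" "Suc n"]
      by (simp add: nth_append Suc_diff_le del: funpow.simps)
    moreover have "lift_ctx \<Delta> @ B # \<Gamma> \<turnstile> Var (Suc n) : (lift 0 ^^ Suc (Suc n)) ((lift_ctx \<Delta> @ B # \<Gamma>) ! Suc n)"
      using c False ty_Var by (intro ctx_typing_jeq.ty_Var) auto
    ultimately show ?thesis using False by simp
  qed
next
  case (ty_Con \<Gamma>' c)
  then show ?case by (auto intro: ctx_typing_jeq.ty_Con)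
next
  case (ty_App \<Gamma>' f A B a)
  then show ?case
    using ctx_typing_jeq.ty_App[where B = "lift (Suc (length \<Delta>)) B"]
    by (simp add: lift_subst_below)
next
  case (eq_App \<Gamma>' f f' A B a a')
  then show ?case
    using ctx_typing_jeq.eq_App[where B = "lift (Suc (length \<Delta>)) B"]
    by (simp add: lift_subst_below)
next
  case (ty_Pi \<Gamma>' A i B j)
  from ty_Pi.IH(1)[OF ty_Pi.prems] ty_Pi.IH(2)[of "A # \<Delta>"] ty_Pi.prems
  show ?case by (auto intro: ctx_typing_jeq.ty_Pi)
next
  case (ty_Lam \<Gamma>' A i b B)
  from ty_Lam.IH(1)[OF ty_Lam.prems] ty_Lam.IH(2)[of "A # \<Delta>"] ty_Lam.prems
  show ?case by (auto intro: ctx_typing_jeq.ty_Lam)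
next
  case (eq_Pi \<Gamma>' A i A' B B' j)
  from eq_Pi.IH(1,2)[OF eq_Pi.prems] eq_Pi.IH(3)[of "A # \<Delta>"] eq_Pi.prems
  show ?case by (auto intro: ctx_typing_jeq.eq_Pi)
next
  case (eq_Lam \<Gamma>' A i A' b b' B)
  from eq_Lam.IH(1,2)[OF eq_Lam.prems] eq_Lam.IH(3)[of "A # \<Delta>"] eq_Lam.prems
  show ?case by (auto intro: ctx_typing_jeq.eq_Lam)
next
  case (eq_beta \<Gamma>' A i b B a)
  from eq_beta.IH(1,3)[OF eq_beta.prems] eq_beta.IH(2)[of "A # \<Delta>"] eq_beta.prems
  show ?case
    using ctx_typing_jeq.eq_beta[where B = "lift (Suc (length \<Delta>)) B"] by (simp add: lift_subst_below)
next
  case (eq_eta \<Gamma>' f A B)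
  from eq_eta.IH[OF eq_eta.prems] show ?case
    using ctx_typing_jeq.eq_eta[where f = "lift (length \<Delta>) f"]
    by (simp add: lift_lift[of 0])
next
  case (eq_comp s t \<Gamma>' T)
  then show ?case by (auto intro: ctx_typing_jeq.eq_comp comp_lift)
qed (auto intro: ctx_typing_jeq.intros)

lemma weaken: "\<Gamma> \<turnstile> B : Univ i \<Longrightarrow> \<Gamma> \<turnstile> t : T \<Longrightarrow> B # \<Gamma> \<turnstile> lift 0 t : lift 0 T"
  using weakening_at(2)[of _ _ _ _ _ _ "[]"] by simp

lemma weaken_eq: "\<Gamma> \<turnstile> B : Univ i \<Longrightarrow> \<Gamma> \<turnstile> s \<equiv> t : T \<Longrightarrow> B # \<Gamma> \<turnstile> lift 0 s \<equiv> lift 0 t : lift 0 T"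
  using weakening_at(3)[of _ _ _ _ _ _ _ "[]"] by simp

fun subst_ctx :: "tm \<Rightarrow> tm list \<Rightarrow> tm list" where
  "subst_ctx s [] = []"
| "subst_ctx s (A # \<Delta>) = subst (length \<Delta>) ((lift 0 ^^ length \<Delta>) s) A # subst_ctx s \<Delta>"

lemma length_subst_ctx [simp]: "length (subst_ctx s \<Delta>) = length \<Delta>"
  by (induction \<Delta>) auto

lemma nth_subst_ctx: "n < length \<Delta> \<Longrightarrow> subst_ctx s \<Delta> ! n
    = subst (length \<Delta> - Suc n) ((lift 0 ^^ (length \<Delta> - Suc n)) s) (\<Delta> ! n)"
  by (induction \<Delta> arbitrary: n) (auto simp: nth_Cons split: nat.splits)

lemma ctx_ConsD: "A # \<Gamma> ctx \<Longrightarrow> \<exists>i. \<Gamma> \<turnstile> A : Univ i"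
  by (erule ctx.cases) auto

lemma weakening_ctx:
  "\<Delta> @ \<Gamma> ctx \<Longrightarrow> \<Gamma> \<turnstile> t : T \<Longrightarrow> \<Delta> @ \<Gamma> \<turnstile> (lift 0 ^^ length \<Delta>) t : (lift 0 ^^ length \<Delta>) T"
proof (induction \<Delta>)
  case (Cons A \<Delta>)
  then obtain i where A: "\<Delta> @ \<Gamma> \<turnstile> A : Univ i" using ctx_ConsD by fastforce
  with Cons have "\<Delta> @ \<Gamma> \<turnstile> (lift 0 ^^ length \<Delta>) t : (lift 0 ^^ length \<Delta>) T"
    using judgment_ctx(2) by blast
  from weaken[OF A this] show ?case by simp
qed simp

text \<open>
  Substitution for a hypothesis in the middle of a context, by the same induction.  Both this lemma and
  weakening hold without knowing that the types in a judgment are themselves well-formed: no rule has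
  a premise that would have to be reconstructed.
\<close>

lemma substitution_at:
  assumes s: "\<Gamma> \<turnstile> s : S"
  shows "\<Gamma>' ctx \<Longrightarrow> (\<And>\<Delta>. \<Gamma>' = \<Delta> @ S # \<Gamma> \<Longrightarrow> subst_ctx s \<Delta> @ \<Gamma> ctx)"
    and "\<Gamma>' \<turnstile> t : T \<Longrightarrow> (\<And>\<Delta>. \<Gamma>' = \<Delta> @ S # \<Gamma> \<Longrightarrow>
           subst_ctx s \<Delta> @ \<Gamma> \<turnstile> subst (length \<Delta>) ((lift 0 ^^ length \<Delta>) s) t
             : subst (length \<Delta>) ((lift 0 ^^ length \<Delta>) s) T)"
    and "\<Gamma>' \<turnstile> u \<equiv> t : T \<Longrightarrow> (\<And>\<Delta>. \<Gamma>' = \<Delta> @ S # \<Gamma> \<Longrightarrow>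
           subst_ctx s \<Delta> @ \<Gamma> \<turnstile> subst (length \<Delta>) ((lift 0 ^^ length \<Delta>) s) u
             \<equiv> subst (length \<Delta>) ((lift 0 ^^ length \<Delta>) s) t
             : subst (length \<Delta>) ((lift 0 ^^ length \<Delta>) s) T)"
proof (induction rule: ctx_typing_jeq.inducts)
  case (ctx_Cons \<Gamma>' A i)
  then show ?case using judgment_ctx(2)[OF s]
    by (cases \<Delta>) (fastforce intro: ctx_typing_jeq.ctx_Cons)+
next
  case (ty_Var \<Gamma>' n)
  then have c: "subst_ctx s \<Delta> @ \<Gamma> ctx" by blast
  consider "n < length \<Delta>" | "n = length \<Delta>" | m where "n = Suc m" "length \<Delta> \<le> m"
    by (metis Suc_le_D Suc_le_mono less_Suc_eq_le linorder_neqE_nat not_less_eq_eq less_eq_Suc_le)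
  then show ?case
  proof cases
    case 1
    then have "subst (length \<Delta>) ((lift 0 ^^ length \<Delta>) s) ((lift 0 ^^ Suc n) (\<Gamma>' ! n))
        = (lift 0 ^^ Suc n) ((subst_ctx s \<Delta> @ \<Gamma>) ! n)"
      using ty_Var subst_liftn_above[of "Suc n" "length \<Delta>"]
      by (simp add: nth_append nth_subst_ctx del: funpow.simps)
    moreover have "subst_ctx s \<Delta> @ \<Gamma> \<turnstile> Var n : (lift 0 ^^ Suc n) ((subst_ctx s \<Delta> @ \<Gamma>) ! n)"
      using c 1 by (intro ctx_typing_jeq.ty_Var) auto
    ultimately show ?thesis using 1 by simp
  next
    case 2
    then have "subst (length \<Delta>) ((lift 0 ^^ length \<Delta>) s) ((lift 0 ^^ Suc n) (\<Gamma>' ! n))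
        = (lift 0 ^^ length \<Delta>) S"
      using ty_Var subst_liftn_below[of "length \<Delta>" n] by (simp add: nth_append del: funpow.simps)
    then show ?thesis using 2 weakening_ctx[OF c s] by simp
  next
    case 3
    then have "subst (length \<Delta>) ((lift 0 ^^ length \<Delta>) s) ((lift 0 ^^ Suc n) (\<Gamma>' ! n))
        = (lift 0 ^^ Suc m) ((subst_ctx s \<Delta> @ \<Gamma>) ! m)"
      using ty_Var subst_liftn_below[of "length \<Delta>" n] by (simp add: nth_append Suc_diff_le del: funpow.simps)
    moreover have "subst_ctx s \<Delta> @ \<Gamma> \<turnstile> Var m : (lift 0 ^^ Suc m) ((subst_ctx s \<Delta> @ \<Gamma>) ! m)"
      using c 3 ty_Var by (intro ctx_typing_jeq.ty_Var) auto
    ultimately show ?thesis using 3 by simp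
  qed
next
  case (ty_Con \<Gamma>' c)
  then show ?case by (auto intro: ctx_typing_jeq.ty_Con)
next
  case (ty_App \<Gamma>' f A B a)
  then show ?case
    using ctx_typing_jeq.ty_App[where B = "subst (Suc (length \<Delta>)) ((lift 0 ^^ Suc (length \<Delta>)) s) B"]
    by (simp add: subst_subst)
next
  case (eq_App \<Gamma>' f f' A B a a')
  then show ?case
    using ctx_typing_jeq.eq_App[where B = "subst (Suc (length \<Delta>)) ((lift 0 ^^ Suc (length \<Delta>)) s) B"]
    by (simp add: subst_subst)
next
  case (ty_Pi \<Gamma>' A i B j)
  from ty_Pi.IH(1)[OF ty_Pi.prems] ty_Pi.IH(2)[of "A # \<Delta>"] ty_Pi.prems
  show ?case by (auto intro: ctx_typing_jeq.ty_Pi)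
next
  case (ty_Lam \<Gamma>' A i b B)
  from ty_Lam.IH(1)[OF ty_Lam.prems] ty_Lam.IH(2)[of "A # \<Delta>"] ty_Lam.prems
  show ?case by (auto intro: ctx_typing_jeq.ty_Lam)
next
  case (eq_Pi \<Gamma>' A i A' B B' j)
  from eq_Pi.IH(1,2)[OF eq_Pi.prems] eq_Pi.IH(3)[of "A # \<Delta>"] eq_Pi.prems
  show ?case by (auto intro: ctx_typing_jeq.eq_Pi)
next
  case (eq_Lam \<Gamma>' A i A' b b' B)
  from eq_Lam.IH(1,2)[OF eq_Lam.prems] eq_Lam.IH(3)[of "A # \<Delta>"] eq_Lam.prems
  show ?case by (auto intro: ctx_typing_jeq.eq_Lam)
next
  case (eq_beta \<Gamma>' A i b B a)
  from eq_beta.IH(1,3)[OF eq_beta.prems] eq_beta.IH(2)[of "A # \<Delta>"] eq_beta.prems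
  show ?case
    using ctx_typing_jeq.eq_beta[where B = "subst (Suc (length \<Delta>)) ((lift 0 ^^ Suc (length \<Delta>)) s) B"]
    by (simp add: subst_subst)
next
  case (eq_eta \<Gamma>' f A B)
  from eq_eta.IH[OF eq_eta.prems] show ?case
    using ctx_typing_jeq.eq_eta[where f = "subst (length \<Delta>) ((lift 0 ^^ length \<Delta>) s) f"]
    by (simp add: lift_subst_above)
next
  case (eq_comp s t \<Gamma>' T)
  then show ?case by (auto intro: ctx_typing_jeq.eq_comp comp_subst)
qed (auto intro: ctx_typing_jeq.intros)

lemma substitution: "\<Gamma> \<turnstile> s : S \<Longrightarrow> S # \<Gamma> \<turnstile> t : T \<Longrightarrow> \<Gamma> \<turnstile> subst 0 s t : subst 0 s T"
  using substitution_at(2)[of _ _ _ _ _ _ "[]"] by simp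

lemma substitution_eq: "\<Gamma> \<turnstile> s : S \<Longrightarrow> S # \<Gamma> \<turnstile> u \<equiv> t : T \<Longrightarrow> \<Gamma> \<turnstile> subst 0 s u \<equiv> subst 0 s t : subst 0 s T"
  using substitution_at(3)[of _ _ _ _ _ _ _ "[]"] by simp

section \<open>Derived rules for the constants\<close>

lemma subst_Suc_lift [simp]: "subst (Suc k) (lift 0 s) (lift 0 t) = lift 0 (subst k s t)"
  by (simp add: lift_subst_above)

lemma subst_Var_lift [simp]: "subst k (Var k) (lift (Suc k) t) = t"
  by (induction t arbitrary: k) auto

lemma subst_lift_lift [simp]:
  "subst (Suc (Suc 0)) s (lift (Suc 0) (lift (Suc 0) t)) = lift (Suc 0) t"
  by (simp add: lift_lift[of "Suc 0" "Suc 0"])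

text \<open>
  A typed term together with a term it is judgmentally equal to.  Nothing is said about the typing
  of the right-hand side: deriving it would need that every type in a judgment is well-formed, in
  particular the type of every constant.  The argument below is arranged so that only left-hand sides
  are ever used as typed terms.
\<close>

definition red :: "tm list \<Rightarrow> tm \<Rightarrow> tm \<Rightarrow> tm \<Rightarrow> bool" where
  "red \<Gamma> t t' T \<longleftrightarrow> \<Gamma> \<turnstile> t : T \<and> \<Gamma> \<turnstile> t \<equiv> t' : T"

lemma red_refl: "\<Gamma> \<turnstile> t : T \<Longrightarrow> red \<Gamma> t t T"
  by (simp add: red_def eq_refl)

lemma red_Con: "\<Gamma> ctx \<Longrightarrow> red \<Gamma> (Con c) (Con c) (close (ctype c))"
  by (simp add: red_refl ty_Con)

lemma red_Univ: "\<Gamma> ctx \<Longrightarrow> red \<Gamma> (Univ i) (Univ i) (Univ (Suc i))"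
  by (simp add: red_refl ty_Univ)

lemma red_App: "red \<Gamma> f f' (Pi A B) \<Longrightarrow> red \<Gamma> a a' A \<Longrightarrow> red \<Gamma> (f \<degree> a) (f' \<degree> a') (subst 0 a B)"
  unfolding red_def by (blast intro: ty_App eq_App)

lemma red_Pi: "red \<Gamma> A A' (Univ i) \<Longrightarrow> red (A # \<Gamma>) B B' (Univ j) \<Longrightarrow> red \<Gamma> (Pi A B) (Pi A' B') (Univ (max i j))"
  unfolding red_def by (blast intro: ty_Pi eq_Pi)

lemma red_Lam: "red \<Gamma> A A' (Univ i) \<Longrightarrow> red (A # \<Gamma>) b b' B \<Longrightarrow> red \<Gamma> (Lam A b) (Lam A' b') (Pi A B)"
  unfolding red_def by (blast intro: ty_Lam eq_Lam)

lemma red_conv: "red \<Gamma> t t' A \<Longrightarrow> \<Gamma> \<turnstile> A \<equiv> B : Univ i \<Longrightarrow> red \<Gamma> t t' B"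
  unfolding red_def by (blast intro: ty_conv eq_conv)

lemma red_conv_sym: "red \<Gamma> t t' B \<Longrightarrow> \<Gamma> \<turnstile> A \<equiv> B : Univ i \<Longrightarrow> red \<Gamma> t t' A"
  by (blast intro: red_conv eq_sym)

lemma red_weaken: "\<Gamma> \<turnstile> B : Univ i \<Longrightarrow> red \<Gamma> t t' T \<Longrightarrow> red (B # \<Gamma>) (lift 0 t) (lift 0 t') (lift 0 T)"
  unfolding red_def by (blast intro: weaken weaken_eq)

lemma red_ctx: "red \<Gamma> t t' T \<Longrightarrow> \<Gamma> ctx"
  unfolding red_def using judgment_ctx(2) by blast

lemma red_ty: "red \<Gamma> t t' T \<Longrightarrow> \<Gamma> \<turnstile> t : T"
  by (simp add: red_def)

lemma red_Var0: "\<Gamma> \<turnstile> A : Univ i \<Longrightarrow> red (A # \<Gamma>) (Var 0) (Var 0) (lift 0 A)"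
  using ty_Var[of "A # \<Gamma>" 0] by (auto intro: red_refl ctx_Cons)

text \<open>
  Applying an abstraction to its own variable gives back the body; this is how the family
  \<open>lift 0 (Lam A B) \<degree> Var 0\<close> in the type of a constant is exchanged for \<open>B\<close>.
\<close>

lemma beta_Var0:
  assumes "\<Gamma> \<turnstile> A : Univ i" "A # \<Gamma> \<turnstile> b : B"
  shows "A # \<Gamma> \<turnstile> lift 0 (Lam A b) \<degree> Var 0 \<equiv> b : B"
proof -
  have "lift 0 A # A # \<Gamma> \<turnstile> lift (Suc 0) b : lift (Suc 0) B"
    using weakening_at(2)[OF assms(1) assms(2), of "[A]"] by simp
  from eq_beta[OF weaken[OF assms(1,1), simplified] this red_ty[OF red_Var0[OF assms(1)]]]
  show ?thesis by simp
qed

text \<open>Here \<open>a\<close> replaces index 1 and \<open>b\<close> index 0 of \<open>t\<close>.\<close>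

definition subst2 :: "tm \<Rightarrow> tm \<Rightarrow> tm \<Rightarrow> tm" where
  "subst2 a b t = subst 0 b (subst (Suc 0) (lift 0 a) t)"

lemma beta2:
  assumes A: "\<Gamma> \<turnstile> A : Univ i" and B: "A # \<Gamma> \<turnstile> B : Univ j" and t: "B # A # \<Gamma> \<turnstile> t : T"
    and a: "\<Gamma> \<turnstile> a : A" and b: "\<Gamma> \<turnstile> b : subst 0 a B"
  shows "\<Gamma> \<turnstile> Lam A (Lam B t) \<degree> a \<degree> b \<equiv> subst2 a b t : subst2 a b T"
proof -
  have "\<Gamma> \<turnstile> Lam A (Lam B t) \<degree> a \<equiv> subst 0 a (Lam B t) : subst 0 a (Pi B T)"
    by (rule eq_beta[OF A ty_Lam[OF B t] a])
  then have "\<Gamma> \<turnstile> Lam A (Lam B t) \<degree> a \<degree> b \<equiv> subst 0 a (Lam B t) \<degree> b : subst2 a b T"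
    using eq_App[OF _ eq_refl[OF b]] by (simp add: subst2_def)
  moreover have "\<Gamma> \<turnstile> subst 0 a B : Univ j"
    using substitution[OF a B] by simp
  moreover have "subst 0 a B # \<Gamma> \<turnstile> subst (Suc 0) (lift 0 a) t : subst (Suc 0) (lift 0 a) T"
    using substitution_at(2)[OF a t, of "[B]"] by simp
  ultimately show ?thesis
    using eq_trans[OF _ eq_beta[OF _ _ b]] by (simp add: subst2_def)
qed

lemma subst2_eq:
  assumes "B # A # \<Gamma> \<turnstile> s \<equiv> t : T" and "\<Gamma> \<turnstile> a : A" and "\<Gamma> \<turnstile> b : subst 0 a B"
  shows "\<Gamma> \<turnstile> subst2 a b s \<equiv> subst2 a b t : subst2 a b T"
  using substitution_eq[OF assms(3) substitution_at(3)[OF assms(2,1), of "[B]", simplified]]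
  by (simp add: subst2_def)

text \<open>
  The applied constants, with their families and methods given as abstractions, as the notation of
  the theory writes them.
\<close>

abbreviation "tId i A a b \<equiv> Con (CId i) \<degree> A \<degree> a \<degree> b"
abbreviation "tRefl i A a \<equiv> Con (CRefl i) \<degree> A \<degree> a"
abbreviation "tJ i j A a C d b p \<equiv>
  Con (CIdInd i j) \<degree> A \<degree> a \<degree> Lam A (Lam (tId i (lift 0 A) (lift 0 a) (Var 0)) C) \<degree> d \<degree> b \<degree> p"
abbreviation "tSig i j A B \<equiv> Con (CSig i j) \<degree> A \<degree> Lam A B"
abbreviation "tPair i j A B a b \<equiv> Con (CPair i j) \<degree> A \<degree> Lam A B \<degree> a \<degree> b"
abbreviation "tSplit i j k A B C g z \<equiv>
  Con (CSigInd i j k) \<degree> A \<degree> Lam A B \<degree> Lam (tSig i j A B) C \<degree> Lam A (Lam B g) \<degree> z"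
abbreviation "tTrunc i A \<equiv> Con (CTrunc i) \<degree> A"
abbreviation "tIn i A a \<equiv> Con (CIn i) \<degree> A \<degree> a"
abbreviation "tSquash i A a b \<equiv> Con (CSquash i) \<degree> A \<degree> a \<degree> b"
abbreviation "tTruncInd i k A C h g z \<equiv>
  Con (CTruncInd i k) \<degree> A \<degree> Lam (tTrunc i A) C \<degree> h \<degree> Lam A g \<degree> z"

lemma red_Id:
  assumes A: "red \<Gamma> A A' (Univ i)" and a: "red \<Gamma> a a' A" and b: "red \<Gamma> b b' A"
  shows "red \<Gamma> (tId i A a b) (tId i A' a' b') (Univ i)"
proof -
  note 1 = red_App[OF red_Con[OF red_ctx[OF A], of "CId i", simplified ctype.simps unfold_pre, simplified] A, simplified]
  note 2 = red_App[OF 1 a, simplified]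
  from red_App[OF 2 b] show ?thesis by simp
qed

lemma red_Refl:
  assumes A: "red \<Gamma> A A' (Univ i)" and a: "red \<Gamma> a a' A"
  shows "red \<Gamma> (tRefl i A a) (tRefl i A' a') (tId i A a a)"
proof -
  note 1 = red_App[OF red_Con[OF red_ctx[OF A], of "CRefl i", simplified ctype.simps unfold_pre, simplified] A, simplified]
  from red_App[OF 1 a] show ?thesis by simp
qed

lemma red_Trunc:
  assumes A: "red \<Gamma> A A' (Univ i)"
  shows "red \<Gamma> (tTrunc i A) (tTrunc i A') (Univ i)"
  using red_App[OF red_Con[OF red_ctx[OF A], of "CTrunc i", simplified ctype.simps unfold_pre, simplified] A, simplified] .

lemma red_In:
  assumes A: "red \<Gamma> A A' (Univ i)" and a: "red \<Gamma> a a' A"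
  shows "red \<Gamma> (tIn i A a) (tIn i A' a') (tTrunc i A)"
proof -
  note 1 = red_App[OF red_Con[OF red_ctx[OF A], of "CIn i", simplified ctype.simps unfold_pre, simplified] A, simplified]
  from red_App[OF 1 a] show ?thesis by simp
qed

lemma red_Squash:
  assumes A: "red \<Gamma> A A' (Univ i)" and a: "red \<Gamma> a a' (tTrunc i A)" and b: "red \<Gamma> b b' (tTrunc i A)"
  shows "red \<Gamma> (tSquash i A a b) (tSquash i A' a' b') (tId i (tTrunc i A) a b)"
proof -
  note 1 = red_App[OF red_Con[OF red_ctx[OF A], of "CSquash i", simplified ctype.simps unfold_pre, simplified] A, simplified]
  note 2 = red_App[OF 1 a, simplified]
  from red_App[OF 2 b] show ?thesis by simp
qed

text \<open>
  Typing an applied constant one argument at a time.  The families are kept opaque here, so that the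
  instances of the type of the constant simplify to the stated form; the rules for families given as
  abstractions follow by \<open>\<beta>\<close>.
\<close>

lemma spine_Sig:
  assumes A: "red \<Gamma> A A' (Univ i)" and P: "red \<Gamma> P P' (Pi A (Univ j))"
  shows "red \<Gamma> (Con (CSig i j) \<degree> A \<degree> P) (Con (CSig i j) \<degree> A' \<degree> P') (Univ (max i j))"
proof -
  note 1 = red_App[OF red_Con[OF red_ctx[OF A], of "CSig i j", simplified ctype.simps unfold_pre, simplified] A, simplified]
  from red_App[OF 1 P] show ?thesis by simp
qed

lemma spine_Pair:
  assumes A: "red \<Gamma> A A' (Univ i)" and P: "red \<Gamma> P P' (Pi A (Univ j))"
    and a: "red \<Gamma> a a' A" and b: "red \<Gamma> b b' (P \<degree> a)"
  shows "red \<Gamma> (Con (CPair i j) \<degree> A \<degree> P \<degree> a \<degree> b) (Con (CPair i j) \<degree> A' \<degree> P' \<degree> a' \<degree> b') (Con (CSig i j) \<degree> A \<degree> P)"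
proof -
  note 1 = red_App[OF red_Con[OF red_ctx[OF A], of "CPair i j", simplified ctype.simps unfold_pre, simplified] A, simplified]
  note 2 = red_App[OF 1 P, simplified]
  note 3 = red_App[OF 2 a, simplified]
  from red_App[OF 3 b] show ?thesis by simp
qed

lemma spine_Split:
  assumes A: "red \<Gamma> A A' (Univ i)" and P: "red \<Gamma> P P' (Pi A (Univ j))"
    and M: "red \<Gamma> M M' (Pi (Con (CSig i j) \<degree> A \<degree> P) (Univ k))"
    and g: "red \<Gamma> g g' (Pi A (Pi (lift 0 P \<degree> Var 0)
      (lift 0 (lift 0 M) \<degree> (Con (CPair i j) \<degree> lift 0 (lift 0 A) \<degree> lift 0 (lift 0 P) \<degree> Var (Suc 0) \<degree> Var 0))))"
    and z: "red \<Gamma> z z' (Con (CSig i j) \<degree> A \<degree> P)"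
  shows "red \<Gamma> (Con (CSigInd i j k) \<degree> A \<degree> P \<degree> M \<degree> g \<degree> z) (Con (CSigInd i j k) \<degree> A' \<degree> P' \<degree> M' \<degree> g' \<degree> z') (M \<degree> z)"
proof -
  note 1 = red_App[OF red_Con[OF red_ctx[OF A], of "CSigInd i j k", simplified ctype.simps unfold_pre, simplified] A, simplified]
  note 2 = red_App[OF 1 P, simplified]
  note 3 = red_App[OF 2 M, simplified]
  note 4 = red_App[OF 3 g, simplified]
  from red_App[OF 4 z] show ?thesis by simp
qed

lemma spine_J:
  assumes A: "red \<Gamma> A A' (Univ i)" and a: "red \<Gamma> a a' A"
    and M: "red \<Gamma> M M' (Pi A (Pi (tId i (lift 0 A) (lift 0 a) (Var 0)) (Univ j)))"
    and d: "red \<Gamma> d d' (M \<degree> a \<degree> tRefl i A a)" and b: "red \<Gamma> b b' A" and p: "red \<Gamma> p p' (tId i A a b)"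
  shows "red \<Gamma> (Con (CIdInd i j) \<degree> A \<degree> a \<degree> M \<degree> d \<degree> b \<degree> p) (Con (CIdInd i j) \<degree> A' \<degree> a' \<degree> M' \<degree> d' \<degree> b' \<degree> p') (M \<degree> b \<degree> p)"
proof -
  note 1 = red_App[OF red_Con[OF red_ctx[OF A], of "CIdInd i j", simplified ctype.simps unfold_pre, simplified] A, simplified]
  note 2 = red_App[OF 1 a, simplified]
  note 3 = red_App[OF 2 M, simplified]
  note 4 = red_App[OF 3 d, simplified]
  note 5 = red_App[OF 4 b, simplified]
  from red_App[OF 5 p] show ?thesis by simp
qed

lemma spine_TruncInd:
  assumes A: "red \<Gamma> A A' (Univ i)" and M: "red \<Gamma> M M' (Pi (tTrunc i A) (Univ k))"
    and h: "red \<Gamma> h h' (Pi (tTrunc i A) (close (isProp k) \<degree> (lift 0 M \<degree> Var 0)))"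
    and g: "red \<Gamma> g g' (Pi A (lift 0 M \<degree> tIn i (lift 0 A) (Var 0)))"
    and z: "red \<Gamma> z z' (tTrunc i A)"
  shows "red \<Gamma> (Con (CTruncInd i k) \<degree> A \<degree> M \<degree> h \<degree> g \<degree> z) (Con (CTruncInd i k) \<degree> A' \<degree> M' \<degree> h' \<degree> g' \<degree> z') (M \<degree> z)"
proof -
  note 1 = red_App[OF red_Con[OF red_ctx[OF A], of "CTruncInd i k", simplified ctype.simps unfold_pre, simplified] A, simplified]
  note 2 = red_App[OF 1 M, simplified]
  note 3 = red_App[OF 2 h[unfolded isProp_def closed_def close_def LAM_def PI_def app_def con_def univ_def bvar_def, simplified], simplified]
  note 4 = red_App[OF 3 g, simplified]
  from red_App[OF 4 z] show ?thesis by simp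
qed

lemma red_Sig:
  assumes A: "red \<Gamma> A A' (Univ i)" and B: "red (A # \<Gamma>) B B' (Univ j)"
  shows "red \<Gamma> (tSig i j A B) (tSig i j A' B') (Univ (max i j))"
  by (rule spine_Sig[OF A red_Lam[OF A B]])

lemma red_Pair:
  assumes A: "red \<Gamma> A A' (Univ i)" and B: "red (A # \<Gamma>) B B' (Univ j)"
    and a: "red \<Gamma> a a' A" and b: "red \<Gamma> b b' (subst 0 a B)"
  shows "red \<Gamma> (tPair i j A B a b) (tPair i j A' B' a' b') (tSig i j A B)"
proof -
  have "\<Gamma> \<turnstile> Lam A B \<degree> a \<equiv> subst 0 a B : Univ j"
    using eq_beta[OF red_ty[OF A] red_ty[OF B] red_ty[OF a]] by simp
  then show ?thesis
    by (intro spine_Pair[OF A red_Lam[OF A B] a] red_conv_sym[OF b])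
qed

text \<open>
  The second part is the computation rule.  It is stated only for a syntactic reflexivity, because then
  both sides have the same type without further conversion.
\<close>

lemma red_J:
  assumes A: "red \<Gamma> A A' (Univ i)" and a: "red \<Gamma> a a' A"
    and C: "red (tId i (lift 0 A) (lift 0 a) (Var 0) # A # \<Gamma>) C C' (Univ j)"
    and d: "red \<Gamma> d d' (subst2 a (tRefl i A a) C)"
    and b: "red \<Gamma> b b' A" and p: "red \<Gamma> p p' (tId i A a b)"
  shows "red \<Gamma> (tJ i j A a C d b p) (tJ i j A' a' C' d' b' p') (subst2 b p C)"
    and "b = a \<Longrightarrow> p = tRefl i A a \<Longrightarrow> red \<Gamma> (tJ i j A a C d b p) d' (subst2 b p C)"
proof -
  let ?I = "tId i (lift 0 A) (lift 0 a) (Var 0)" and ?I' = "tId i (lift 0 A') (lift 0 a') (Var 0)"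
  have I: "red (A # \<Gamma>) ?I ?I' (Univ i)"
    using red_Id[OF red_weaken[OF red_ty[OF A] A, simplified] red_weaken[OF red_ty[OF A] a] red_Var0[OF red_ty[OF A]]] .
  let ?M = "Lam A (Lam ?I C)" and ?M' = "Lam A' (Lam ?I' C')"
  have M: "red \<Gamma> ?M ?M' (Pi A (Pi ?I (Univ j)))"
    by (intro red_Lam[OF A] red_Lam[OF I] C)
  have app: "\<Gamma> \<turnstile> ?M \<degree> x \<degree> q \<equiv> subst2 x q C : Univ j" if "\<Gamma> \<turnstile> x : A" "\<Gamma> \<turnstile> q : tId i A a x" for x q
    using beta2[OF red_ty[OF A] red_ty[OF I] red_ty[OF C] that(1)] that(2) by (simp add: subst2_def)
  have r: "\<Gamma> \<turnstile> tRefl i A a : tId i A a a" using red_ty[OF red_Refl[OF A a]] .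
  have "red \<Gamma> (tJ i j A a C d b p) (tJ i j A' a' C' d' b' p') (?M \<degree> b \<degree> p)"
    by (rule spine_J[OF A a M red_conv_sym[OF d app[OF red_ty[OF a] r]] b p])
  from red_conv[OF this app[OF red_ty[OF b] red_ty[OF p]]]
  show *: "red \<Gamma> (tJ i j A a C d b p) (tJ i j A' a' C' d' b' p') (subst2 b p C)" .
  assume eq: "b = a" "p = tRefl i A a"
  show "red \<Gamma> (tJ i j A a C d b p) d' (subst2 b p C)"
    using eq_trans[OF eq_comp[OF comp_Id]] d * eq unfolding red_def by blast
qed

text \<open>
  The method \<open>g\<close> is typed in the context of the two components, where the motive is taken at the pair of
  the two variables; \<open>D\<close> below is that instance.
\<close>

lemma red_Split:
  assumes A: "red \<Gamma> A A' (Univ i)" and B: "red (A # \<Gamma>) B B' (Univ j)"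
    and C: "red (tSig i j A B # \<Gamma>) C C' (Univ k)"
    and g: "red (B # A # \<Gamma>) g g' (subst 0
      (tPair i j (lift 0 (lift 0 A)) (lift (Suc 0) (lift (Suc 0) B)) (Var (Suc 0)) (Var 0))
      (lift (Suc 0) (lift (Suc 0) C)))"
    and z: "red \<Gamma> z z' (tSig i j A B)"
  shows "red \<Gamma> (tSplit i j k A B C g z) (tSplit i j k A' B' C' g' z') (subst 0 z C)"
    and "z = tPair i j A B x y \<Longrightarrow> \<Gamma> \<turnstile> x : A \<Longrightarrow> \<Gamma> \<turnstile> y : subst 0 x B \<Longrightarrow>
      red \<Gamma> (tSplit i j k A B C g z) (subst2 x y g') (subst 0 z C)"
proof -
  let ?P = "Lam A B" and ?M = "Lam (tSig i j A B) C"
  let ?q = "tPair i j (lift 0 (lift 0 A)) (lift (Suc 0) (lift (Suc 0) B)) (Var (Suc 0)) (Var 0)"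
  let ?D = "subst 0 ?q (lift (Suc 0) (lift (Suc 0) C))"
  note tyA = red_ty[OF A] and tyB = red_ty[OF B]
  have P: "red \<Gamma> ?P (Lam A' B') (Pi A (Univ j))" by (rule red_Lam[OF A B])
  have S: "red \<Gamma> (tSig i j A B) (tSig i j A' B') (Univ (max i j))" by (rule red_Sig[OF A B])
  have M: "red \<Gamma> ?M (Lam (tSig i j A' B') C') (Pi (tSig i j A B) (Univ k))" by (rule red_Lam[OF S C])
  have g0: "red \<Gamma> (Lam A (Lam B g)) (Lam A' (Lam B' g')) (Pi A (Pi B ?D))"
    by (intro red_Lam[OF A] red_Lam[OF B] g)
  have B0: "A # \<Gamma> \<turnstile> lift 0 ?P \<degree> Var 0 \<equiv> B : Univ j" by (rule beta_Var0[OF tyA tyB])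
  have A1: "A # \<Gamma> \<turnstile> lift 0 A : Univ i" using weaken[OF tyA tyA] by simp
  have A2: "B # A # \<Gamma> \<turnstile> lift 0 (lift 0 A) : Univ i" using weaken[OF tyB A1] by simp
  have B1: "lift 0 A # A # \<Gamma> \<turnstile> lift (Suc 0) B : Univ j"
    using weakening_at(2)[OF tyA tyB, of "[A]"] by simp
  have B2: "lift 0 (lift 0 A) # B # A # \<Gamma> \<turnstile> lift (Suc 0) (lift (Suc 0) B) : Univ j"
    using weakening_at(2)[OF tyB B1, of "[lift 0 A]"] by simp
  have C1: "lift 0 (tSig i j A B) # A # \<Gamma> \<turnstile> lift (Suc 0) C : Univ k"
    using weakening_at(2)[OF tyA red_ty[OF C], of "[tSig i j A B]"] by simp
  have C2: "lift 0 (lift 0 (tSig i j A B)) # B # A # \<Gamma> \<turnstile> lift (Suc 0) (lift (Suc 0) C) : Univ k"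
    using weakening_at(2)[OF tyB C1, of "[lift 0 (tSig i j A B)]"] by simp
  have v1: "B # A # \<Gamma> \<turnstile> Var (Suc 0) : lift 0 (lift 0 A)"
    using weaken[OF tyB red_ty[OF red_Var0[OF tyA]]] by simp
  have "(lift (Suc 0) (lift (Suc 0) B)) = lift (Suc (Suc 0)) (lift (Suc 0) B)" by (simp add: lift_lift)
  then have v0: "B # A # \<Gamma> \<turnstile> Var 0 : subst 0 (Var (Suc 0)) (lift (Suc 0) (lift (Suc 0) B))"
    using red_ty[OF red_Var0[OF tyB]] lift_subst_below[of 0 0 "Var 0" "lift (Suc 0) B"] by simp
  have q: "B # A # \<Gamma> \<turnstile> ?q : lift 0 (lift 0 (tSig i j A B))"
    using red_ty[OF red_Pair[OF red_refl[OF A2] red_refl[OF B2] red_refl[OF v1] red_refl[OF v0]]] by simp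
  have "B # A # \<Gamma> \<turnstile> lift 0 (lift 0 ?M) \<degree> ?q \<equiv> ?D : Univ k"
    using eq_beta[OF _ C2 q, of "max i j"] weaken[OF tyB weaken[OF tyA red_ty[OF S]]] by simp
  then have "A # \<Gamma> \<turnstile> Pi (lift 0 ?P \<degree> Var 0) (lift 0 (lift 0 ?M) \<degree> ?q) \<equiv> Pi B ?D : Univ (max j k)"
    using eq_sym[OF eq_Pi[OF tyB eq_sym[OF B0] eq_sym]] by blast
  then have "\<Gamma> \<turnstile> Pi A (Pi (lift 0 ?P \<degree> Var 0) (lift 0 (lift 0 ?M) \<degree> ?q)) \<equiv> Pi A (Pi B ?D) : Univ (max i (max j k))"
    by (rule eq_Pi[OF tyA eq_refl[OF tyA]])
  from spine_Split[OF A P M _ z] red_conv_sym[OF g0 this]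
  have "red \<Gamma> (tSplit i j k A B C g z) (tSplit i j k A' B' C' g' z') (?M \<degree> z)" by simp
  moreover have "\<Gamma> \<turnstile> ?M \<degree> z \<equiv> subst 0 z C : Univ k"
    using eq_beta[OF red_ty[OF S] red_ty[OF C] red_ty[OF z]] by simp
  ultimately show *: "red \<Gamma> (tSplit i j k A B C g z) (tSplit i j k A' B' C' g' z') (subst 0 z C)"
    by (rule red_conv)
  assume zq: "z = tPair i j A B x y" and x: "\<Gamma> \<turnstile> x : A" and y: "\<Gamma> \<turnstile> y : subst 0 x B"
  have D: "subst2 x y ?D = subst 0 z C"
    by (simp add: subst2_def subst_subst[of 0] zq)
  have *: "\<Gamma> \<turnstile> tSplit i j k A B C g z : subst 0 z C" using * by (rule red_ty)
  have "\<Gamma> \<turnstile> Lam A (Lam B g) \<degree> x \<degree> y \<equiv> subst2 x y g : subst 0 z C"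
    using beta2[OF tyA tyB red_ty[OF g] x y] unfolding D .
  moreover have "\<Gamma> \<turnstile> subst2 x y g \<equiv> subst2 x y g' : subst 0 z C"
    using subst2_eq[OF _ x y] g unfolding red_def D[symmetric] by blast
  moreover have "\<Gamma> \<turnstile> Lam A (Lam B g) \<degree> x \<degree> y : subst 0 z C"
    using ty_App[OF ty_App[OF ty_Lam[OF tyA ty_Lam[OF tyB red_ty[OF g]]] x, unfolded subst.simps(4)] y]
      D[unfolded subst2_def] by (simp only:)
  ultimately show "red \<Gamma> (tSplit i j k A B C g z) (subst2 x y g') (subst 0 z C)"
    using eq_trans[OF eq_comp[OF comp_Sig]] zq * eq_trans unfolding red_def by blast
qed

lemma isProp_unfold:
  assumes C: "\<Gamma> \<turnstile> C : Univ k"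
  shows "\<Gamma> \<turnstile> close (isProp k) \<degree> C \<equiv> Pi C (Pi (lift 0 C) (tId k (lift 0 (lift 0 C)) (Var (Suc 0)) (Var 0))) : Univ k"
    and "\<Gamma> ctx \<Longrightarrow> \<Gamma> \<turnstile> close (isProp k) : Pi (Univ k) (Univ k)"
proof -
  let ?b = "Pi (Var 0) (Pi (Var (Suc 0)) (tId k (Var (Suc (Suc 0))) (Var (Suc 0)) (Var 0)))"
  have eq: "close (isProp k) = Lam (Univ k) ?b" by (simp add: unfold_pre)
  have U: "\<Gamma> \<turnstile> Univ k : Univ (Suc k)" if "\<Gamma> ctx" for \<Gamma> using that by (rule ty_Univ)
  have b: "Univ k # \<Gamma> \<turnstile> ?b : Univ k" if c: "\<Gamma> ctx" for \<Gamma>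
  proof -
    have 0: "Univ k # \<Gamma> \<turnstile> Var 0 : Univ k" using red_ty[OF red_Var0[OF U[OF c]]] by simp
    have 1: "Var 0 # Univ k # \<Gamma> \<turnstile> Var (Suc 0) : Univ k" using weaken[OF 0 0] by simp
    have 2: "Var (Suc 0) # Var 0 # Univ k # \<Gamma> \<turnstile> Var (Suc (Suc 0)) : Univ k" using weaken[OF 1 1] by simp
    have x: "Var (Suc 0) # Var 0 # Univ k # \<Gamma> \<turnstile> Var (Suc 0) : Var (Suc (Suc 0))"
      using weaken[OF 1 red_ty[OF red_Var0[OF 0]]] by simp
    have y: "Var (Suc 0) # Var 0 # Univ k # \<Gamma> \<turnstile> Var 0 : Var (Suc (Suc 0))"
      using red_ty[OF red_Var0[OF 1]] by simp
    from ty_Pi[OF 0 ty_Pi[OF 1 red_ty[OF red_Id[OF red_refl[OF 2] red_refl[OF x] red_refl[OF y]]]]]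
    show ?thesis by simp
  qed
  from ty_Lam[OF U b] eq show "\<Gamma> \<turnstile> close (isProp k) : Pi (Univ k) (Univ k)" if "\<Gamma> ctx" using that by simp
  from eq_beta[OF U b C] judgment_ctx(2)[OF C] eq
  show "\<Gamma> \<turnstile> close (isProp k) \<degree> C \<equiv> Pi C (Pi (lift 0 C) (tId k (lift 0 (lift 0 C)) (Var (Suc 0)) (Var 0))) : Univ k"
    by simp
qed

lemma red_TruncInd:
  assumes A: "red \<Gamma> A A' (Univ i)" and C: "red (tTrunc i A # \<Gamma>) C C' (Univ k)"
    and h: "red \<Gamma> h h' (Pi (tTrunc i A)
       (Pi C (Pi (lift 0 C) (tId k (lift 0 (lift 0 C)) (Var (Suc 0)) (Var 0)))))"
    and g: "red (A # \<Gamma>) g g' (subst 0 (tIn i (lift 0 A) (Var 0)) (lift (Suc 0) C))"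
    and z: "red \<Gamma> z z' (tTrunc i A)"
  shows "red \<Gamma> (tTruncInd i k A C h g z) (tTruncInd i k A' C' h' g' z') (subst 0 z C)"
    and "z = tIn i A x \<Longrightarrow> \<Gamma> \<turnstile> x : A \<Longrightarrow>
      red \<Gamma> (tTruncInd i k A C h g z) (subst 0 x g') (subst 0 z C)"
proof -
  let ?M = "Lam (tTrunc i A) C"
  let ?D = "subst 0 (tIn i (lift 0 A) (Var 0)) (lift (Suc 0) C)"
  note tyA = red_ty[OF A]
  have T: "red \<Gamma> (tTrunc i A) (tTrunc i A') (Univ i)" by (rule red_Trunc[OF A])
  note tyT = red_ty[OF T] and tyC = red_ty[OF C]
  have M: "red \<Gamma> ?M (Lam (tTrunc i A') C') (Pi (tTrunc i A) (Univ k))" by (rule red_Lam[OF T C])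
  have "tTrunc i A # \<Gamma> \<turnstile> lift 0 ?M \<degree> Var 0 \<equiv> C : Univ k" by (rule beta_Var0[OF tyT tyC])
  then have "tTrunc i A # \<Gamma> \<turnstile> close (isProp k) \<degree> (lift 0 ?M \<degree> Var 0) \<equiv> close (isProp k) \<degree> C : Univ k"
    using eq_App[OF eq_refl[OF isProp_unfold(2)[OF tyC judgment_ctx(2)[OF tyC]]]] by simp
  from eq_Pi[OF tyT eq_refl[OF tyT] eq_trans[OF this isProp_unfold(1)[OF tyC]]]
  have h': "red \<Gamma> h h' (Pi (tTrunc i A) (close (isProp k) \<degree> (lift 0 ?M \<degree> Var 0)))"
    by (rule red_conv_sym[OF h])
  have A1: "red (A # \<Gamma>) (lift 0 A) (lift 0 A) (Univ i)" using weaken[OF tyA tyA] by (simp add: red_refl)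
  have C1: "lift 0 (tTrunc i A) # A # \<Gamma> \<turnstile> lift (Suc 0) C : Univ k"
    using weakening_at(2)[OF tyA tyC, of "[tTrunc i A]"] by simp
  have n: "A # \<Gamma> \<turnstile> tIn i (lift 0 A) (Var 0) : lift 0 (tTrunc i A)"
    using red_ty[OF red_In[OF A1 red_Var0[OF tyA]]] by simp
  have "A # \<Gamma> \<turnstile> lift 0 ?M \<degree> tIn i (lift 0 A) (Var 0) \<equiv> ?D : Univ k"
    using eq_beta[OF _ C1 n] weaken[OF tyA tyT] by simp
  from eq_Pi[OF tyA eq_refl[OF tyA] this]
  have g0: "red \<Gamma> (Lam A g) (Lam A' g') (Pi A (lift 0 ?M \<degree> tIn i (lift 0 A) (Var 0)))"
    by (rule red_conv_sym[OF red_Lam[OF A g]])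
  have "red \<Gamma> (tTruncInd i k A C h g z) (tTruncInd i k A' C' h' g' z') (?M \<degree> z)"
    by (rule spine_TruncInd[OF A M h' g0 z])
  moreover have "\<Gamma> \<turnstile> ?M \<degree> z \<equiv> subst 0 z C : Univ k"
    using eq_beta[OF tyT tyC red_ty[OF z]] by simp
  ultimately show *: "red \<Gamma> (tTruncInd i k A C h g z) (tTruncInd i k A' C' h' g' z') (subst 0 z C)"
    by (rule red_conv)
  assume zx: "z = tIn i A x" and x: "\<Gamma> \<turnstile> x : A"
  have D: "subst 0 x ?D = subst 0 z C"
    by (simp add: subst_subst[of 0] zx)
  have "\<Gamma> \<turnstile> Lam A g \<degree> x \<equiv> subst 0 x g : subst 0 z C"
    using eq_beta[OF tyA red_ty[OF g] x] unfolding D .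
  moreover have "\<Gamma> \<turnstile> subst 0 x g \<equiv> subst 0 x g' : subst 0 z C"
    using substitution_eq[OF x] g D unfolding red_def by metis
  moreover have "\<Gamma> \<turnstile> Lam A g \<degree> x : subst 0 z C"
    using ty_App[OF ty_Lam[OF tyA red_ty[OF g]] x] unfolding D .
  moreover have "\<Gamma> \<turnstile> tTruncInd i k A C h g z : subst 0 z C" using * by (rule red_ty)
  ultimately show "red \<Gamma> (tTruncInd i k A C h g z) (subst 0 x g') (subst 0 z C)"
    using eq_trans[OF eq_comp[OF comp_Trunc]] zx eq_trans unfolding red_def by blast
qed

section \<open>Terms with applied constants\<close>

text \<open>
  Terms in which the constants occur fully applied and their families and methods are given by their
  bodies, so that the binders need no annotation: \<open>ESplit\<close> and \<open>ETruncInd\<close> bind one variable in the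
  motive, \<open>EJ\<close> binds two, and the methods of \<open>ESplit\<close> and \<open>ETruncInd\<close> bind two and one.  Substituting into
  these bodies replaces the \<open>\<beta>\<close>-conversions that an eliminator would otherwise leave in its type.
\<close>

datatype expr =
    EVar nat | EUniv nat | EPi expr expr | ELam expr expr | EApp expr expr
  | ESig nat nat expr expr | EPair nat nat expr expr expr expr | ESplit nat nat nat expr expr expr expr expr
  | EId nat expr expr expr | ERefl nat expr expr | EJ nat nat expr expr expr expr expr expr
  | ETrunc nat expr | EIn nat expr expr | ESquash nat expr expr expr | ETruncInd nat nat expr expr expr expr expr

text \<open>Lifting by \<open>m\<close> of the indices from \<open>k\<close> on.\<close>

primrec xlift :: "nat \<Rightarrow> nat \<Rightarrow> expr \<Rightarrow> expr" where
  "xlift m k (EVar n) = EVar (if n < k then n else n + m)"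
| "xlift m k (EUniv i) = EUniv i"
| "xlift m k (EPi A B) = EPi (xlift m k A) (xlift m (Suc k) B)"
| "xlift m k (ELam A b) = ELam (xlift m k A) (xlift m (Suc k) b)"
| "xlift m k (EApp f a) = EApp (xlift m k f) (xlift m k a)"
| "xlift m k (ESig i j A B) = ESig i j (xlift m k A) (xlift m (Suc k) B)"
| "xlift m k (EPair i j A B a b) = EPair i j (xlift m k A) (xlift m (Suc k) B) (xlift m k a) (xlift m k b)"
| "xlift m k (ESplit i j l A B C g z) = ESplit i j l (xlift m k A) (xlift m (Suc k) B) (xlift m (Suc k) C) (xlift m (Suc (Suc k)) g) (xlift m k z)"
| "xlift m k (EId i A a b) = EId i (xlift m k A) (xlift m k a) (xlift m k b)"
| "xlift m k (ERefl i A a) = ERefl i (xlift m k A) (xlift m k a)"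
| "xlift m k (EJ i j A a C d b p) = EJ i j (xlift m k A) (xlift m k a) (xlift m (Suc (Suc k)) C) (xlift m k d) (xlift m k b) (xlift m k p)"
| "xlift m k (ETrunc i A) = ETrunc i (xlift m k A)"
| "xlift m k (EIn i A a) = EIn i (xlift m k A) (xlift m k a)"
| "xlift m k (ESquash i A a b) = ESquash i (xlift m k A) (xlift m k a) (xlift m k b)"
| "xlift m k (ETruncInd i j A C h g z) = ETruncInd i j (xlift m k A) (xlift m (Suc k) C) (xlift m k h) (xlift m (Suc k) g) (xlift m k z)"

text \<open>
  The substituted term is lifted only where it is inserted, so \<open>s\<close> lives outside the \<open>k\<close> binders that have
  been passed, unlike the term substituted by \<open>subst k\<close>.
\<close>

primrec xsubst :: "nat \<Rightarrow> expr \<Rightarrow> expr \<Rightarrow> expr" where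
  "xsubst k s (EVar n) = (if n < k then EVar n else if n = k then xlift k 0 s else EVar (n - 1))"
| "xsubst k s (EUniv i) = EUniv i"
| "xsubst k s (EPi A B) = EPi (xsubst k s A) (xsubst (Suc k) s B)"
| "xsubst k s (ELam A b) = ELam (xsubst k s A) (xsubst (Suc k) s b)"
| "xsubst k s (EApp f a) = EApp (xsubst k s f) (xsubst k s a)"
| "xsubst k s (ESig i j A B) = ESig i j (xsubst k s A) (xsubst (Suc k) s B)"
| "xsubst k s (EPair i j A B a b) = EPair i j (xsubst k s A) (xsubst (Suc k) s B) (xsubst k s a) (xsubst k s b)"
| "xsubst k s (ESplit i j l A B C g z) = ESplit i j l (xsubst k s A) (xsubst (Suc k) s B) (xsubst (Suc k) s C) (xsubst (Suc (Suc k)) s g) (xsubst k s z)"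
| "xsubst k s (EId i A a b) = EId i (xsubst k s A) (xsubst k s a) (xsubst k s b)"
| "xsubst k s (ERefl i A a) = ERefl i (xsubst k s A) (xsubst k s a)"
| "xsubst k s (EJ i j A a C d b p) = EJ i j (xsubst k s A) (xsubst k s a) (xsubst (Suc (Suc k)) s C) (xsubst k s d) (xsubst k s b) (xsubst k s p)"
| "xsubst k s (ETrunc i A) = ETrunc i (xsubst k s A)"
| "xsubst k s (EIn i A a) = EIn i (xsubst k s A) (xsubst k s a)"
| "xsubst k s (ESquash i A a b) = ESquash i (xsubst k s A) (xsubst k s a) (xsubst k s b)"
| "xsubst k s (ETruncInd i j A C h g z) = ETruncInd i j (xsubst k s A) (xsubst (Suc k) s C) (xsubst k s h) (xsubst (Suc k) s g) (xsubst k s z)"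

definition xsubst2 :: "expr \<Rightarrow> expr \<Rightarrow> expr \<Rightarrow> expr" where
  "xsubst2 b c t = xsubst 0 c (xsubst (Suc 0) b t)"

abbreviation "up \<equiv> xlift (Suc 0) 0"

fun dest_Lam :: "expr \<Rightarrow> (expr \<times> expr) option" where
  "dest_Lam (ELam A b) = Some (A, b)"
| "dest_Lam _ = None"

fun dest_Pi :: "expr \<Rightarrow> (expr \<times> expr) option" where
  "dest_Pi (EPi A B) = Some (A, B)"
| "dest_Pi _ = None"

fun dest_Univ :: "expr \<Rightarrow> nat option" where
  "dest_Univ (EUniv i) = Some i"
| "dest_Univ _ = None"

lemma funpow_lift_simps [simp]:
  "(lift k ^^ m) (Univ i) = Univ i" "(lift k ^^ m) (Con c) = Con c"
  "(lift k ^^ m) (Pi A B) = Pi ((lift k ^^ m) A) ((lift (Suc k) ^^ m) B)"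
  "(lift k ^^ m) (Lam A B) = Lam ((lift k ^^ m) A) ((lift (Suc k) ^^ m) B)"
  "(lift k ^^ m) (f \<degree> a) = (lift k ^^ m) f \<degree> (lift k ^^ m) a"
  "(lift k ^^ m) (Var n) = Var (if n < k then n else n + m)"
  by (induction m) auto

lemma funpow_lift_Suc_lift [simp]: "(lift (Suc k) ^^ m) (lift 0 t) = lift 0 ((lift k ^^ m) t)"
  by (induction m) (auto simp: lift_lift[of 0 k])

primrec embed :: "expr \<Rightarrow> tm" where
  "embed (EVar n) = Var n"
| "embed (EUniv i) = Univ i"
| "embed (EPi A B) = Pi (embed A) (embed B)"
| "embed (ELam A b) = Lam (embed A) (embed b)"
| "embed (EApp f a) = embed f \<degree> embed a"
| "embed (ESig i j A B) = tSig i j (embed A) (embed B)"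
| "embed (EPair i j A B a b) = tPair i j (embed A) (embed B) (embed a) (embed b)"
| "embed (ESplit i j k A B C g z) = tSplit i j k (embed A) (embed B) (embed C) (embed g) (embed z)"
| "embed (EId i A a b) = tId i (embed A) (embed a) (embed b)"
| "embed (ERefl i A a) = tRefl i (embed A) (embed a)"
| "embed (EJ i j A a C d b p) = tJ i j (embed A) (embed a) (embed C) (embed d) (embed b) (embed p)"
| "embed (ETrunc i A) = tTrunc i (embed A)"
| "embed (EIn i A a) = tIn i (embed A) (embed a)"
| "embed (ESquash i A a b) = tSquash i (embed A) (embed a) (embed b)"
| "embed (ETruncInd i k A C h g z) = tTruncInd i k (embed A) (embed C) (embed h) (embed g) (embed z)"

lemma embed_xlift [simp]: "embed (xlift m k e) = (lift k ^^ m) (embed e)"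
  by (induction e arbitrary: k) auto

lemma embed_xsubst: "embed (xsubst k s e) = subst k ((lift 0 ^^ k) (embed s)) (embed e)"
  by (induction e arbitrary: k) auto

lemma embed_xsubst0 [simp]: "embed (xsubst 0 s e) = subst 0 (embed s) (embed e)"
  by (simp add: embed_xsubst)

lemma embed_xsubst2 [simp]: "embed (xsubst2 a b e) = subst2 (embed a) (embed b) (embed e)"
  by (simp add: xsubst2_def subst2_def embed_xsubst)

lemma dest_Lam_iff [simp]: "dest_Lam e = Some (A, b) \<longleftrightarrow> e = ELam A b" by (cases e) auto
lemma dest_Pi_iff [simp]: "dest_Pi e = Some (A, b) \<longleftrightarrow> e = EPi A b" by (cases e) auto
lemma dest_Univ_iff [simp]: "dest_Univ e = Some i \<longleftrightarrow> e = EUniv i" by (cases e) auto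

definition lam_over :: "expr \<Rightarrow> expr \<Rightarrow> expr option" where
  "lam_over A e = do { (A', b) \<leftarrow> dest_Lam e; if A' = A then Some b else None }"

primrec papp :: "expr \<Rightarrow> expr list \<Rightarrow> expr" where
  "papp f [] = f" | "papp f (x # xs) = papp (EApp f x) xs"

primrec pcon :: "const \<Rightarrow> expr list \<Rightarrow> expr option" where
  "pcon (CSig i j) xs = (case xs of [A, B] \<Rightarrow> do { B \<leftarrow> lam_over A B; Some (ESig i j A B) } | _ \<Rightarrow> None)"
| "pcon (CPair i j) xs = (case xs of [A, B, a, b] \<Rightarrow> do { B \<leftarrow> lam_over A B; Some (EPair i j A B a b) } | _ \<Rightarrow> None)"
| "pcon (CSigInd i j k) xs = (case xs of A # B # C # g # z # ys \<Rightarrow> do {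
     B \<leftarrow> lam_over A B; C \<leftarrow> lam_over (ESig i j A B) C; g \<leftarrow> lam_over A g; g \<leftarrow> lam_over B g;
     Some (papp (ESplit i j k A B C g z) ys) } | _ \<Rightarrow> None)"
| "pcon (CSum i j) xs = None"
| "pcon (CInl i j) xs = None"
| "pcon (CInr i j) xs = None"
| "pcon (CSumInd i j k) xs = None"
| "pcon (CEmpty i) xs = None"
| "pcon (CEmptyInd i k) xs = None"
| "pcon (CUnit i) xs = None"
| "pcon (CStar i) xs = None"
| "pcon (CUnitInd i k) xs = None"
| "pcon CNat xs = None"
| "pcon CZero xs = None"
| "pcon CSucc xs = None"
| "pcon (CNatInd k) xs = None"
| "pcon (CId i) xs = (case xs of [A, a, b] \<Rightarrow> Some (EId i A a b) | _ \<Rightarrow> None)"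
| "pcon (CRefl i) xs = (case xs of [A, a] \<Rightarrow> Some (ERefl i A a) | _ \<Rightarrow> None)"
| "pcon (CIdInd i j) xs = (case xs of A # a # C # d # b # p # ys \<Rightarrow> do {
     C \<leftarrow> lam_over A C; C \<leftarrow> lam_over (EId i (up A) (up a) (EVar 0)) C; Some (papp (EJ i j A a C d b p) ys) } | _ \<Rightarrow> None)"
| "pcon (CTrunc i) xs = (case xs of [A] \<Rightarrow> Some (ETrunc i A) | _ \<Rightarrow> None)"
| "pcon (CIn i) xs = (case xs of [A, a] \<Rightarrow> Some (EIn i A a) | _ \<Rightarrow> None)"
| "pcon (CSquash i) xs = (case xs of [A, a, b] \<Rightarrow> Some (ESquash i A a b) | _ \<Rightarrow> None)"
| "pcon (CTruncInd i j) xs = (case xs of A # C # h # g # z # ys \<Rightarrow> do {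
     C \<leftarrow> lam_over (ETrunc i A) C; g \<leftarrow> lam_over A g; Some (papp (ETruncInd i j A C h g z) ys) } | _ \<Rightarrow> None)"
| "pcon (CFunext i j) xs = None"
| "pcon (CUnivalence i) xs = None"

text \<open>
  Translation of terms into the annotation-free syntax.  The second argument of \<open>parse\<close> collects the
  arguments that the head is applied to; annotations that differ from those implied by the context are
  refused.
\<close>

primrec parse :: "tm \<Rightarrow> expr list \<Rightarrow> expr option" where
  "parse (Var n) xs = Some (papp (EVar n) xs)"
| "parse (Univ i) xs = Some (papp (EUniv i) xs)"
| "parse (Con c) xs = pcon c xs"
| "parse (Pi A B) xs = do { A \<leftarrow> parse A []; B \<leftarrow> parse B []; Some (papp (EPi A B) xs) }"
| "parse (Lam A b) xs = do { A \<leftarrow> parse A []; b \<leftarrow> parse b []; Some (papp (ELam A b) xs) }"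
| "parse (f \<degree> a) xs = do { a \<leftarrow> parse a []; parse f (a # xs) }"

lemma lam_over_iff [simp]: "lam_over A e = Some b \<longleftrightarrow> e = ELam A b"
  by (auto simp: lam_over_def bind_eq_Some_conv)

lemma embed_papp [simp]: "embed (papp f xs) = foldl (\<degree>) (embed f) (map embed xs)"
  by (induction xs arbitrary: f) auto

lemma pcon_sound: "pcon c xs = Some e \<Longrightarrow> embed e = foldl (\<degree>) (Con c) (map embed xs)"
  by (cases c) (auto simp: bind_eq_Some_conv split: list.splits)

lemma parse_sound: "parse t xs = Some e \<Longrightarrow> embed e = foldl (\<degree>) t (map embed xs)"
  by (induction t arbitrary: xs e) (auto simp: bind_eq_Some_conv dest: pcon_sound)

section \<open>A type checker\<close>

primrec entry :: "expr list \<Rightarrow> nat \<Rightarrow> expr option" where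
  "entry [] n = None"
| "entry (A # \<Gamma>) n = (case n of 0 \<Rightarrow> Some A | Suc m \<Rightarrow> entry \<Gamma> m)"

text \<open>
  A checker maps a context and a term \<open>t\<close> to a type \<open>T\<close>, a reduct \<open>t'\<close> of \<open>t\<close> and a number \<open>d\<close> of leading
  abstractions of \<open>t'\<close> that may be contracted when \<open>t\<close> is applied.
\<close>

type_synonym checker = "expr list \<Rightarrow> expr \<Rightarrow> (expr \<times> expr \<times> nat) option"

definition sort_of where
  "sort_of r = do { (T, t', d) \<leftarrow> r; i \<leftarrow> dest_Univ T; Some (i, t') }"

text \<open>An arbitrary bound on the number of reduction steps.\<close>

definition "steps = Suc (Suc (Suc (Suc (Suc (Suc (Suc (Suc (Suc (Suc (Suc (Suc 0)))))))))))"

text \<open>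
  Convertibility of types, by reducing both sides in lockstep.  The checker \<open>K\<close> re-checks every reduct
  before it is reduced further, so that no subject reduction is needed.  The crosswise comparisons
  matter for speed: often one side is a definition that unfolds to the other side.
\<close>

primrec conv :: "checker \<Rightarrow> nat \<Rightarrow> expr list \<Rightarrow> expr \<Rightarrow> expr \<Rightarrow> nat option" where
  "conv K 0 \<Gamma> S T = None"
| "conv K (Suc m) \<Gamma> S T = do { (k, S') \<leftarrow> sort_of (K \<Gamma> S); (l, T') \<leftarrow> sort_of (K \<Gamma> T);
     if l = k then
       if S' = T' \<or> S' = T \<or> S = T' then Some k
       else do { n \<leftarrow> conv K m \<Gamma> S' T'; if n = k then Some k else None }
     else None }"

primrec expose_Pi :: "checker \<Rightarrow> nat \<Rightarrow> expr list \<Rightarrow> expr \<Rightarrow> (expr \<times> expr) option" where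
  "expose_Pi K 0 \<Gamma> T = None"
| "expose_Pi K (Suc m) \<Gamma> T = (case dest_Pi T of Some x \<Rightarrow> Some x
     | None \<Rightarrow> do { (k, T') \<leftarrow> sort_of (K \<Gamma> T); expose_Pi K m \<Gamma> T' })"

text \<open>
  The reduct in the result \<open>r\<close> of a check, provided that the type found is convertible to \<open>A\<close>.
\<close>

definition against where "against K \<Gamma> A r = do {
  (T, t', d) \<leftarrow> r; if T = A then Some t' else do { _ \<leftarrow> conv K steps \<Gamma> T A; Some t' } }"

definition has_sort where "has_sort i r = do { (j, t') \<leftarrow> sort_of r; if j = i then Some t' else None }"

text \<open>
  One pass over a term, with \<open>K\<close> used only on types.  A redex is contracted with the unreduced argument:
  the reduct of an argument is not known to be typed.  Likewise an eliminator computes only on a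
  constructor that literally repeats its parameters; if they differ, the next pass may have made them
  equal.
\<close>

primrec step :: "checker \<Rightarrow> expr \<Rightarrow> expr list \<Rightarrow> (expr \<times> expr \<times> nat) option" where
  "step K (EVar n) \<Gamma> = do { A \<leftarrow> entry \<Gamma> n; Some (xlift (Suc n) 0 A, EVar n, 0) }"
| "step K (EUniv i) \<Gamma> = Some (EUniv (Suc i), EUniv i, 0)"
| "step K (EPi A B) \<Gamma> = do { (i, A') \<leftarrow> sort_of (step K A \<Gamma>); (j, B') \<leftarrow> sort_of (step K B (A # \<Gamma>));
     Some (EUniv (max i j), EPi A' B', 0) }"
| "step K (ELam A b) \<Gamma> = do { (i, A') \<leftarrow> sort_of (step K A \<Gamma>); (B, b', d) \<leftarrow> step K b (A # \<Gamma>);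
     Some (EPi A B, ELam A' b', Suc d) }"
| "step K (EApp f a) \<Gamma> = do { (T, f', d) \<leftarrow> step K f \<Gamma>; (A, B) \<leftarrow> expose_Pi K steps \<Gamma> T; a' \<leftarrow> against K \<Gamma> A (step K a \<Gamma>);
     (case d of 0 \<Rightarrow> Some (xsubst 0 a B, EApp f' a', 0)
      | Suc e \<Rightarrow> do { (_, b') \<leftarrow> dest_Lam f'; Some (xsubst 0 a B, xsubst 0 a b', e) }) }"
| "step K (ESig i j A B) \<Gamma> = do { A' \<leftarrow> has_sort i (step K A \<Gamma>); B' \<leftarrow> has_sort j (step K B (A # \<Gamma>));
     Some (EUniv (max i j), ESig i j A' B', 0) }"
| "step K (EPair i j A B a b) \<Gamma> = do { A' \<leftarrow> has_sort i (step K A \<Gamma>); B' \<leftarrow> has_sort j (step K B (A # \<Gamma>));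
     a' \<leftarrow> against K \<Gamma> A (step K a \<Gamma>); b' \<leftarrow> against K \<Gamma> (xsubst 0 a B) (step K b \<Gamma>);
     Some (ESig i j A B, EPair i j A' B' a' b', 0) }"
| "step K (ESplit i j k A B C g z) \<Gamma> = do { A' \<leftarrow> has_sort i (step K A \<Gamma>); B' \<leftarrow> has_sort j (step K B (A # \<Gamma>));
     C' \<leftarrow> has_sort k (step K C (ESig i j A B # \<Gamma>));
     g' \<leftarrow> against K (B # A # \<Gamma>)
        (xsubst 0 (EPair i j (xlift (Suc (Suc 0)) 0 A) (xlift (Suc (Suc 0)) (Suc 0) B) (EVar (Suc 0)) (EVar 0)) (xlift (Suc (Suc 0)) (Suc 0) C)) (step K g (B # A # \<Gamma>));
     z' \<leftarrow> against K \<Gamma> (ESig i j A B) (step K z \<Gamma>);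
     Some (xsubst 0 z C, (case z of EPair i' j' A2 B2 x y \<Rightarrow> if i' = i \<and> j' = j \<and> A2 = A \<and> B2 = B then xsubst2 x y g' else ESplit i j k A' B' C' g' z'
       | _ \<Rightarrow> ESplit i j k A' B' C' g' z'), 0) }"
| "step K (EId i A a b) \<Gamma> = do { A' \<leftarrow> has_sort i (step K A \<Gamma>); a' \<leftarrow> against K \<Gamma> A (step K a \<Gamma>); b' \<leftarrow> against K \<Gamma> A (step K b \<Gamma>);
     Some (EUniv i, EId i A' a' b', 0) }"
| "step K (ERefl i A a) \<Gamma> = do { A' \<leftarrow> has_sort i (step K A \<Gamma>); a' \<leftarrow> against K \<Gamma> A (step K a \<Gamma>);
     Some (EId i A a a, ERefl i A' a', 0) }"
| "step K (EJ i j A a C d b p) \<Gamma> = do { A' \<leftarrow> has_sort i (step K A \<Gamma>); a' \<leftarrow> against K \<Gamma> A (step K a \<Gamma>);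
     C' \<leftarrow> has_sort j (step K C (EId i (up A) (up a) (EVar 0) # A # \<Gamma>));
     d' \<leftarrow> against K \<Gamma> (xsubst2 a (ERefl i A a) C) (step K d \<Gamma>);
     b' \<leftarrow> against K \<Gamma> A (step K b \<Gamma>); p' \<leftarrow> against K \<Gamma> (EId i A a b) (step K p \<Gamma>);
     Some (xsubst2 b p C, if b = a \<and> p = ERefl i A a then d' else EJ i j A' a' C' d' b' p', 0) }"
| "step K (ETrunc i A) \<Gamma> = do { A' \<leftarrow> has_sort i (step K A \<Gamma>); Some (EUniv i, ETrunc i A', 0) }"
| "step K (EIn i A a) \<Gamma> = do { A' \<leftarrow> has_sort i (step K A \<Gamma>); a' \<leftarrow> against K \<Gamma> A (step K a \<Gamma>);
     Some (ETrunc i A, EIn i A' a', 0) }"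
| "step K (ESquash i A a b) \<Gamma> = do { A' \<leftarrow> has_sort i (step K A \<Gamma>); a' \<leftarrow> against K \<Gamma> (ETrunc i A) (step K a \<Gamma>);
     b' \<leftarrow> against K \<Gamma> (ETrunc i A) (step K b \<Gamma>); Some (EId i (ETrunc i A) a b, ESquash i A' a' b', 0) }"
| "step K (ETruncInd i k A C h g z) \<Gamma> = do { A' \<leftarrow> has_sort i (step K A \<Gamma>);
     C' \<leftarrow> has_sort k (step K C (ETrunc i A # \<Gamma>));
     h' \<leftarrow> against K \<Gamma> (EPi (ETrunc i A) (EPi C (EPi (up C) (EId k (xlift (Suc (Suc 0)) 0 C) (EVar (Suc 0)) (EVar 0))))) (step K h \<Gamma>);
     g' \<leftarrow> against K (A # \<Gamma>) (xsubst 0 (EIn i (up A) (EVar 0)) (xlift (Suc 0) (Suc 0) C)) (step K g (A # \<Gamma>));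
     z' \<leftarrow> against K \<Gamma> (ETrunc i A) (step K z \<Gamma>);
     Some (xsubst 0 z C, (case z of EIn i' A2 x \<Rightarrow> if i' = i \<and> A2 = A then xsubst 0 x g' else ETruncInd i k A' C' h' g' z'
        | _ \<Rightarrow> ETruncInd i k A' C' h' g' z'), 0) }"

primrec check :: "nat \<Rightarrow> checker" where
  "check 0 \<Gamma> t = None"
| "check (Suc n) \<Gamma> t = step (check n) t \<Gamma>"

section \<open>Soundness of the checker\<close>

text \<open>
  The invariant behind contracting several abstractions in one pass.  A reduct \<open>Lam A' b\<close> of \<open>f\<close> may be
  contracted if its body is equal to \<open>f\<close> applied to the variable.  This equation is about the original term
  \<open>f\<close>, so instantiating the variable yields \<open>f \<degree> a \<equiv> subst 0 a b\<close> without knowing that \<open>Lam A' b\<close> is typed, and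
  without injectivity of \<open>Pi\<close>.
\<close>

primrec lamok :: "nat \<Rightarrow> tm list \<Rightarrow> tm \<Rightarrow> tm \<Rightarrow> tm \<Rightarrow> bool" where
  "lamok 0 \<Gamma> f f' T \<longleftrightarrow> True"
| "lamok (Suc d) \<Gamma> f f' T \<longleftrightarrow> (\<exists>A A' b B. f' = Lam A' b \<and> T = Pi A B \<and>
     A # \<Gamma> \<turnstile> lift 0 f \<degree> Var 0 \<equiv> b : B \<and> lamok d (A # \<Gamma>) (lift 0 f \<degree> Var 0) b B)"

lemma lamok_cong: "\<Gamma> \<turnstile> g \<equiv> f : T \<Longrightarrow> lamok d \<Gamma> f f' T \<Longrightarrow> lamok d \<Gamma> g f' T"
proof (induction d arbitrary: \<Gamma> f g f' T)
  case (Suc d)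
  then obtain A A' b B where *: "f' = Lam A' b" "T = Pi A B"
    "A # \<Gamma> \<turnstile> lift 0 f \<degree> Var 0 \<equiv> b : B" "lamok d (A # \<Gamma>) (lift 0 f \<degree> Var 0) b B" by auto
  then obtain i where A: "\<Gamma> \<turnstile> A : Univ i" using ctx_ConsD judgment_ctx(3) by blast
  have "A # \<Gamma> \<turnstile> lift 0 g \<degree> Var 0 \<equiv> lift 0 f \<degree> Var 0 : B"
    using eq_App[OF weaken_eq[OF A Suc.prems(1), unfolded *(2), simplified] eq_refl[OF red_ty[OF red_Var0[OF A]]]]
    by simp
  with Suc.IH[OF this *(4)] * show ?case by (auto intro: eq_trans)
qed simp

lemma lamok_Lam:
  assumes A: "\<Gamma> \<turnstile> A : Univ i" and b: "red (A # \<Gamma>) b b' B" and d: "lamok d (A # \<Gamma>) b b' B"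
  shows "lamok (Suc d) \<Gamma> (Lam A b) (Lam A' b') (Pi A B)"
proof -
  have *: "A # \<Gamma> \<turnstile> lift 0 (Lam A b) \<degree> Var 0 \<equiv> b : B"
    by (rule beta_Var0[OF A red_ty[OF b]])
  with b have "A # \<Gamma> \<turnstile> lift 0 (Lam A b) \<degree> Var 0 \<equiv> b' : B"
    unfolding red_def by (blast intro: eq_trans)
  with lamok_cong[OF * d] show ?thesis by auto
qed

lemma lamok_subst_at:
  assumes a: "\<Gamma> \<turnstile> a : A"
  shows "lamok d (\<Delta> @ A # \<Gamma>) f f' T \<Longrightarrow>
    lamok d (subst_ctx a \<Delta> @ \<Gamma>) (subst (length \<Delta>) ((lift 0 ^^ length \<Delta>) a) f)
     (subst (length \<Delta>) ((lift 0 ^^ length \<Delta>) a) f') (subst (length \<Delta>) ((lift 0 ^^ length \<Delta>) a) T)"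
proof (induction d arbitrary: \<Delta> f f' T)
  case (Suc d)
  then obtain C C' b B where *: "f' = Lam C' b" "T = Pi C B"
    "(C # \<Delta>) @ A # \<Gamma> \<turnstile> lift 0 f \<degree> Var 0 \<equiv> b : B" "lamok d ((C # \<Delta>) @ A # \<Gamma>) (lift 0 f \<degree> Var 0) b B" by auto
  from substitution_at(3)[OF a *(3) refl] Suc.IH[OF *(4)] *(1,2)
  show ?case by simp
qed simp

lemma lamok_App:
  assumes f: "lamok (Suc d) \<Gamma> f (Lam A' b) (Pi A B)" "\<Gamma> \<turnstile> f : Pi A B" and a: "\<Gamma> \<turnstile> a : A"
  shows "red \<Gamma> (f \<degree> a) (subst 0 a b) (subst 0 a B)"
    and "lamok d \<Gamma> (f \<degree> a) (subst 0 a b) (subst 0 a B)"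
proof -
  from f have 1: "A # \<Gamma> \<turnstile> lift 0 f \<degree> Var 0 \<equiv> b : B" and 2: "lamok d ([] @ A # \<Gamma>) (lift 0 f \<degree> Var 0) b B"
    by auto
  from substitution_eq[OF a 1] ty_App[OF f(2) a]
  show "red \<Gamma> (f \<degree> a) (subst 0 a b) (subst 0 a B)" by (simp add: red_def)
  from lamok_subst_at[OF a 2]
  show "lamok d \<Gamma> (f \<degree> a) (subst 0 a b) (subst 0 a B)" by simp
qed

text \<open>
  What the computation rules need about their scrutinee: the components of a pair or of a truncated
  point cannot be recovered from the type of the whole.
\<close>

definition parts_typed :: "expr list \<Rightarrow> expr \<Rightarrow> bool" where
  "parts_typed \<Gamma> t \<longleftrightarrow>
     (\<forall>i j A B a b. t = EPair i j A B a b \<longrightarrow>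
        map embed \<Gamma> \<turnstile> embed a : embed A \<and> map embed \<Gamma> \<turnstile> embed b : subst 0 (embed a) (embed B)) \<and>
     (\<forall>i A a. t = EIn i A a \<longrightarrow> map embed \<Gamma> \<turnstile> embed a : embed A)"

definition good_result :: "expr list \<Rightarrow> expr \<Rightarrow> expr \<Rightarrow> expr \<Rightarrow> nat \<Rightarrow> bool" where
  "good_result \<Gamma> t T t' d \<longleftrightarrow>
     red (map embed \<Gamma>) (embed t) (embed t') (embed T) \<and>
     lamok d (map embed \<Gamma>) (embed t) (embed t') (embed T) \<and> parts_typed \<Gamma> t"

definition good :: "expr list \<Rightarrow> expr \<Rightarrow> (expr \<times> expr \<times> nat) option \<Rightarrow> bool" where
  "good \<Gamma> t r \<longleftrightarrow> (\<forall>T t' d. r = Some (T, t', d) \<longrightarrow>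
     good_result \<Gamma> t T t' d)"

definition sound :: "checker \<Rightarrow> bool" where
  "sound K \<longleftrightarrow> (\<forall>\<Gamma> t. (map embed \<Gamma>) ctx \<longrightarrow> good \<Gamma> t (K \<Gamma> t))"

lemma sort_of_sound: "good \<Gamma> t r \<Longrightarrow> sort_of r = Some (i, t') \<Longrightarrow> red (map embed \<Gamma>) (embed t) (embed t') (Univ i)"
  by (fastforce simp: good_result_def good_def sort_of_def bind_eq_Some_conv)

lemma has_sort_sound: "good \<Gamma> t r \<Longrightarrow> has_sort i r = Some t' \<Longrightarrow> red (map embed \<Gamma>) (embed t) (embed t') (Univ i)"
  by (auto simp: has_sort_def bind_eq_Some_conv split: if_splits dest: sort_of_sound)

lemma conv_sound:
  assumes "sound K"
  shows "(map embed \<Gamma>) ctx \<Longrightarrow> conv K m \<Gamma> S T = Some k \<Longrightarrow> map embed \<Gamma> \<turnstile> embed S \<equiv> embed T : Univ k"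
proof (induction m arbitrary: S T k)
  case (Suc m)
  then obtain S' T' where S: "sort_of (K \<Gamma> S) = Some (k, S')" and T: "sort_of (K \<Gamma> T) = Some (k, T')"
    and r: "S' = T' \<or> S' = T \<or> S = T' \<or> conv K m \<Gamma> S' T' = Some k"
    by (auto simp: bind_eq_Some_conv split: if_splits)
  have "map embed \<Gamma> \<turnstile> embed S \<equiv> embed S' : Univ k" "map embed \<Gamma> \<turnstile> embed T \<equiv> embed T' : Univ k"
    using assms Suc.prems(1) sort_of_sound[OF _ S] sort_of_sound[OF _ T] by (auto simp: sound_def red_def)
  with r Suc.IH[OF Suc.prems(1)] show ?case by (blast intro: eq_trans eq_sym)
qed simp

lemma against_sound:
  assumes K: "sound K" and c: "(map embed \<Gamma>) ctx" and t: "good \<Gamma> t r" and r: "against K \<Gamma> A r = Some t'"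
  shows "red (map embed \<Gamma>) (embed t) (embed t') (embed A)" and "parts_typed \<Gamma> t"
proof -
  from r obtain T t'' d where *: "r = Some (T, t'', d)"
    and r': "(if T = A then Some t'' else do { _ \<leftarrow> conv K steps \<Gamma> T A; Some t'' }) = Some t'"
    by (auto simp: against_def bind_eq_Some_conv)
  with t have red: "red (map embed \<Gamma>) (embed t) (embed t'') (embed T)" and "parts_typed \<Gamma> t"
    by (auto simp: good_result_def good_def)
  then show "parts_typed \<Gamma> t" by simp
  show "red (map embed \<Gamma>) (embed t) (embed t') (embed A)"
  proof (cases "T = A")
    case False
    with r' obtain k where "conv K steps \<Gamma> T A = Some k" "t' = t''" by (auto simp: bind_eq_Some_conv)
    with conv_sound[OF K c] red show ?thesis by (blast intro: red_conv)
  qed (use r' red in auto)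
qed

lemma expose_Pi_sound:
  assumes "sound K"
  shows "(map embed \<Gamma>) ctx \<Longrightarrow> expose_Pi K m \<Gamma> T = Some (A, B) \<Longrightarrow>
    red (map embed \<Gamma>) f f' (embed T) \<Longrightarrow> red (map embed \<Gamma>) f f' (Pi (embed A) (embed B))"
proof (induction m arbitrary: T)
  case (Suc m)
  show ?case
  proof (cases "dest_Pi T")
    case None
    with Suc.prems(2) obtain k T' where T: "sort_of (K \<Gamma> T) = Some (k, T')" and p: "expose_Pi K m \<Gamma> T' = Some (A, B)"
      by (auto simp: bind_eq_Some_conv)
    have "map embed \<Gamma> \<turnstile> embed T \<equiv> embed T' : Univ k"
      using assms Suc.prems(1) sort_of_sound[OF _ T] by (auto simp: sound_def red_def)
    with Suc.IH[OF Suc.prems(1) p] Suc.prems(3) show ?thesis by (blast intro: red_conv)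
  next
    case (Some x)
    with Suc.prems show ?thesis by (cases x) auto
  qed
qed simp

lemma entry_nth: "entry \<Gamma> n = Some A \<Longrightarrow> n < length \<Gamma> \<and> \<Gamma> ! n = A"
  by (induction \<Gamma> arbitrary: n) (auto split: nat.splits)

lemma step_sound:
  assumes K: "sound K"
  shows "(map embed \<Gamma>) ctx \<Longrightarrow> good \<Gamma> t (step K t \<Gamma>)"
proof (induction t arbitrary: \<Gamma>)
  case (EVar n)
  then show ?case
    using red_refl[OF ty_Var[of "map embed \<Gamma>" n]]
    by (auto simp: good_result_def good_def parts_typed_def bind_eq_Some_conv dest!: entry_nth simp del: funpow.simps)
next
  case (EUniv i)
  then show ?case by (simp add: good_result_def good_def parts_typed_def red_Univ)
next
  case (EPi A B)
  show ?case unfolding good_def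
  proof (intro allI impI)
    fix T t' d assume "step K (EPi A B) \<Gamma> = Some (T, t', d)"
    then obtain i A' j B' where A: "sort_of (step K A \<Gamma>) = Some (i, A')" and B: "sort_of (step K B (A # \<Gamma>)) = Some (j, B')"
      and eq: "T = EUniv (max i j)" "t' = EPi A' B'" "d = 0"
      by (auto simp: bind_eq_Some_conv)
    note A = sort_of_sound[OF EPi.IH(1)[OF EPi.prems] A]
    have "(map embed (A # \<Gamma>)) ctx" using ctx_Cons red_ty[OF A] by auto
    note B = sort_of_sound[OF EPi.IH(2)[OF this] B]
    from red_Pi[OF A B[simplified]] eq show "good_result \<Gamma> (EPi A B) T t' d"
      by (simp add: good_result_def parts_typed_def)
  qed
next
  case (ELam A b)
  show ?case unfolding good_def
  proof (intro allI impI)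
    fix T t' d assume "step K (ELam A b) \<Gamma> = Some (T, t', d)"
    then obtain i A' B b' e where A: "sort_of (step K A \<Gamma>) = Some (i, A')" and B: "step K b (A # \<Gamma>) = Some (B, b', e)"
      and eq: "T = EPi A B" "t' = ELam A' b'" "d = Suc e"
      by (auto simp: bind_eq_Some_conv)
    note A = sort_of_sound[OF ELam.IH(1)[OF ELam.prems] A]
    have "(map embed (A # \<Gamma>)) ctx" using ctx_Cons red_ty[OF A] by auto
    from ELam.IH(2)[OF this] B have b: "red (embed A # map embed \<Gamma>) (embed b) (embed b') (embed B)"
      "lamok e (embed A # map embed \<Gamma>) (embed b) (embed b') (embed B)" by (auto simp: good_result_def good_def)
    from red_Lam[OF A b(1)] lamok_Lam[OF red_ty[OF A] b, of "embed A'"] eq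
    show "good_result \<Gamma> (ELam A b) T t' d"
      by (simp add: good_result_def parts_typed_def del: lamok.simps)
  qed
next
  case (EApp f a)
  show ?case unfolding good_def
  proof (intro allI impI)
    fix T t' d assume "step K (EApp f a) \<Gamma> = Some (T, t', d)"
    then obtain F f' e A B a' where f: "step K f \<Gamma> = Some (F, f', e)" and p: "expose_Pi K steps \<Gamma> F = Some (A, B)"
      and a: "against K \<Gamma> A (step K a \<Gamma>) = Some a'"
      and r: "(case e of 0 \<Rightarrow> Some (xsubst 0 a B, EApp f' a', 0)
        | Suc e \<Rightarrow> do { (_, b') \<leftarrow> dest_Lam f'; Some (xsubst 0 a B, xsubst 0 a b', e) }) = Some (T, t', d)"
      by (auto simp: bind_eq_Some_conv)
    note a = against_sound(1)[OF K EApp.prems EApp.IH(2)[OF EApp.prems] a]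
    from f EApp.IH(1)[OF EApp.prems] have f: "red (map embed \<Gamma>) (embed f) (embed f') (embed F)"
      "lamok e (map embed \<Gamma>) (embed f) (embed f') (embed F)" by (auto simp: good_result_def good_def)
    note f' = expose_Pi_sound[OF K EApp.prems p f(1)]
    have "red (map embed \<Gamma>) (embed (EApp f a)) (embed t') (embed T) \<and>
      lamok d (map embed \<Gamma>) (embed (EApp f a)) (embed t') (embed T)"
    proof (cases e)
      case 0
      with r red_App[OF f' a] show ?thesis by auto
    next
      case (Suc e')
      with r obtain A0 b' where eq: "f' = ELam A0 b'" "T = xsubst 0 a B" "t' = xsubst 0 a b'" "d = e'"
        by (auto simp: bind_eq_Some_conv)
      from f(2) Suc obtain A1 B1 where "embed F = Pi A1 B1" by auto
      then have "\<exists>A B. F = EPi A B" by (cases F) auto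
      with p have "F = EPi A B" by (auto simp: steps_def)
      with f(2) Suc eq(1) have "lamok (Suc e') (map embed \<Gamma>) (embed f) (Lam (embed A0) (embed b')) (Pi (embed A) (embed B))"
        by simp
      from lamok_App[OF this red_ty[OF f'] red_ty[OF a]] eq show ?thesis by simp
    qed
    then show "good_result \<Gamma> (EApp f a) T t' d"
      by (simp add: good_result_def parts_typed_def)
  qed
next
  case (ESig i j A B)
  show ?case unfolding good_def
  proof (intro allI impI)
    fix T t' d assume "step K (ESig i j A B) \<Gamma> = Some (T, t', d)"
    then obtain A' B' where A: "has_sort i (step K A \<Gamma>) = Some A'" and B: "has_sort j (step K B (A # \<Gamma>)) = Some B'"
      and eq: "T = EUniv (max i j)" "t' = ESig i j A' B'" "d = 0"
      by (auto simp: bind_eq_Some_conv)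
    note A = has_sort_sound[OF ESig.IH(1)[OF ESig.prems] A]
    have "(map embed (A # \<Gamma>)) ctx" using ctx_Cons red_ty[OF A] by auto
    note B = has_sort_sound[OF ESig.IH(2)[OF this] B]
    from red_Sig[OF A B[simplified]] eq show "good_result \<Gamma> (ESig i j A B) T t' d"
      by (simp add: good_result_def parts_typed_def)
  qed
next
  case (EPair i j A B a b)
  show ?case unfolding good_def
  proof (intro allI impI)
    fix T t' d assume "step K (EPair i j A B a b) \<Gamma> = Some (T, t', d)"
    then obtain A' B' a' b' where A: "has_sort i (step K A \<Gamma>) = Some A'" and B: "has_sort j (step K B (A # \<Gamma>)) = Some B'"
      and a: "against K \<Gamma> A (step K a \<Gamma>) = Some a'" and b: "against K \<Gamma> (xsubst 0 a B) (step K b \<Gamma>) = Some b'"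
      and eq: "T = ESig i j A B" "t' = EPair i j A' B' a' b'" "d = 0"
      by (auto simp: bind_eq_Some_conv)
    note A = has_sort_sound[OF EPair.IH(1)[OF EPair.prems] A]
    have "(map embed (A # \<Gamma>)) ctx" using ctx_Cons red_ty[OF A] by auto
    note B = has_sort_sound[OF EPair.IH(2)[OF this] B]
    note a = against_sound(1)[OF K EPair.prems EPair.IH(3)[OF EPair.prems] a]
    note b = against_sound(1)[OF K EPair.prems EPair.IH(4)[OF EPair.prems] b]
    from red_Pair[OF A B[simplified] a b[simplified]] red_ty[OF a] red_ty[OF b] eq
    show "good_result \<Gamma> (EPair i j A B a b) T t' d"
      by (simp add: good_result_def parts_typed_def)
  qed
next
  case (ESplit i j k A B C g z)
  show ?case unfolding good_def
  proof (intro allI impI)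
    fix T t' d assume "step K (ESplit i j k A B C g z) \<Gamma> = Some (T, t', d)"
    then obtain A' B' C' g' z' where A: "has_sort i (step K A \<Gamma>) = Some A'" and B: "has_sort j (step K B (A # \<Gamma>)) = Some B'"
      and C: "has_sort k (step K C (ESig i j A B # \<Gamma>)) = Some C'"
      and g: "against K (B # A # \<Gamma>)
        (xsubst 0 (EPair i j (xlift (Suc (Suc 0)) 0 A) (xlift (Suc (Suc 0)) (Suc 0) B) (EVar (Suc 0)) (EVar 0)) (xlift (Suc (Suc 0)) (Suc 0) C)) (step K g (B # A # \<Gamma>)) = Some g'"
      and z: "against K \<Gamma> (ESig i j A B) (step K z \<Gamma>) = Some z'"
      and eq: "T = xsubst 0 z C" "d = 0"
        "t' = (case z of EPair i' j' A2 B2 x y \<Rightarrow> if i' = i \<and> j' = j \<and> A2 = A \<and> B2 = B then xsubst2 x y g' else ESplit i j k A' B' C' g' z'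
          | _ \<Rightarrow> ESplit i j k A' B' C' g' z')"
      by (auto simp: bind_eq_Some_conv)
    note A = has_sort_sound[OF ESplit.IH(1)[OF ESplit.prems] A]
    have c: "(map embed (A # \<Gamma>)) ctx" using ctx_Cons red_ty[OF A] by auto
    note B = has_sort_sound[OF ESplit.IH(2)[OF c] B, simplified]
    have c: "(map embed (B # A # \<Gamma>)) ctx" using ctx_Cons red_ty[OF B] by auto
    note g = against_sound(1)[OF K c ESplit.IH(4)[OF c] g, simplified]
    have c: "(map embed (ESig i j A B # \<Gamma>)) ctx" using ctx_Cons red_ty[OF red_Sig[OF A B]] by auto
    note C = has_sort_sound[OF ESplit.IH(3)[OF c] C, simplified]
    note z = against_sound[OF K ESplit.prems ESplit.IH(5)[OF ESplit.prems] z, simplified]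
    note r = red_Split[OF A B C g z(1)]
    have "red (map embed \<Gamma>) (embed (ESplit i j k A B C g z)) (embed t') (embed T)"
    proof (cases "\<exists>x y. z = EPair i j A B x y")
      case True
      then obtain x y where zq: "z = EPair i j A B x y" by blast
      with z(2) r(2)[of "embed x" "embed y"] eq show ?thesis by (simp add: good_result_def parts_typed_def)
    next
      case False
      then have "t' = ESplit i j k A' B' C' g' z'" using eq(3) by (auto split: expr.splits)
      with r(1) eq(1) show ?thesis by simp
    qed
    with eq(2) show "good_result \<Gamma> (ESplit i j k A B C g z) T t' d"
      by (simp add: good_result_def parts_typed_def)
  qed
next
  case (EId i A a b)
  show ?case unfolding good_def
  proof (intro allI impI)
    fix T t' d assume "step K (EId i A a b) \<Gamma> = Some (T, t', d)"
    then obtain A' a' b' where A: "has_sort i (step K A \<Gamma>) = Some A'"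
      and a: "against K \<Gamma> A (step K a \<Gamma>) = Some a'" and b: "against K \<Gamma> A (step K b \<Gamma>) = Some b'"
      and eq: "T = EUniv i" "t' = EId i A' a' b'" "d = 0"
      by (auto simp: bind_eq_Some_conv)
    note A = has_sort_sound[OF EId.IH(1)[OF EId.prems] A]
    note a = against_sound(1)[OF K EId.prems EId.IH(2)[OF EId.prems] a]
    note b = against_sound(1)[OF K EId.prems EId.IH(3)[OF EId.prems] b]
    from red_Id[OF A a b] eq
    show "good_result \<Gamma> (EId i A a b) T t' d"
      by (simp add: good_result_def parts_typed_def)
  qed
next
  case (ERefl i A a)
  show ?case unfolding good_def
  proof (intro allI impI)
    fix T t' d assume "step K (ERefl i A a) \<Gamma> = Some (T, t', d)"
    then obtain A' a' where A: "has_sort i (step K A \<Gamma>) = Some A'"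
      and a: "against K \<Gamma> A (step K a \<Gamma>) = Some a'"
      and eq: "T = EId i A a a" "t' = ERefl i A' a'" "d = 0"
      by (auto simp: bind_eq_Some_conv)
    note A = has_sort_sound[OF ERefl.IH(1)[OF ERefl.prems] A]
    note a = against_sound(1)[OF K ERefl.prems ERefl.IH(2)[OF ERefl.prems] a]
    from red_Refl[OF A a] eq
    show "good_result \<Gamma> (ERefl i A a) T t' d"
      by (simp add: good_result_def parts_typed_def)
  qed
next
  case (EJ i j A a C d b p)
  show ?case unfolding good_def
  proof (intro allI impI)
    fix T t' n assume "step K (EJ i j A a C d b p) \<Gamma> = Some (T, t', n)"
    then obtain A' a' C' d' b' p' where A: "has_sort i (step K A \<Gamma>) = Some A'"
      and a: "against K \<Gamma> A (step K a \<Gamma>) = Some a'"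
      and C: "has_sort j (step K C (EId i (up A) (up a) (EVar 0) # A # \<Gamma>)) = Some C'"
      and d: "against K \<Gamma> (xsubst2 a (ERefl i A a) C) (step K d \<Gamma>) = Some d'"
      and b: "against K \<Gamma> A (step K b \<Gamma>) = Some b'" and p: "against K \<Gamma> (EId i A a b) (step K p \<Gamma>) = Some p'"
      and eq: "T = xsubst2 b p C" "t' = (if b = a \<and> p = ERefl i A a then d' else EJ i j A' a' C' d' b' p')" "n = 0"
      by (auto simp: bind_eq_Some_conv)
    note A = has_sort_sound[OF EJ.IH(1)[OF EJ.prems] A]
    note a = against_sound(1)[OF K EJ.prems EJ.IH(2)[OF EJ.prems] a]
    note b = against_sound(1)[OF K EJ.prems EJ.IH(5)[OF EJ.prems] b]
    have c: "(map embed (EId i (up A) (up a) (EVar 0) # A # \<Gamma>)) ctx"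
      using ctx_Cons[OF red_ty[OF red_Id[OF red_weaken[OF red_ty[OF A] A, simplified] red_weaken[OF red_ty[OF A] a] red_Var0[OF red_ty[OF A]]]]]
      by simp
    note C = has_sort_sound[OF EJ.IH(3)[OF c] C, simplified]
    note d = against_sound(1)[OF K EJ.prems EJ.IH(4)[OF EJ.prems] d, simplified]
    note p = against_sound(1)[OF K EJ.prems EJ.IH(6)[OF EJ.prems] p, simplified]
    from red_J[OF A a C d b p] eq
    show "good_result \<Gamma> (EJ i j A a C d b p) T t' n"
      by (auto simp add: good_result_def parts_typed_def)
  qed
next
  case (ETrunc i A)
  show ?case unfolding good_def
  proof (intro allI impI)
    fix T t' d assume "step K (ETrunc i A) \<Gamma> = Some (T, t', d)"
    then obtain A' where A: "has_sort i (step K A \<Gamma>) = Some A'"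
      and eq: "T = EUniv i" "t' = ETrunc i A'" "d = 0"
      by (auto simp: bind_eq_Some_conv)
    note A = has_sort_sound[OF ETrunc.IH(1)[OF ETrunc.prems] A]
    from red_Trunc[OF A] eq
    show "good_result \<Gamma> (ETrunc i A) T t' d"
      by (simp add: good_result_def parts_typed_def)
  qed
next
  case (EIn i A a)
  show ?case unfolding good_def
  proof (intro allI impI)
    fix T t' d assume "step K (EIn i A a) \<Gamma> = Some (T, t', d)"
    then obtain A' a' where A: "has_sort i (step K A \<Gamma>) = Some A'"
      and a: "against K \<Gamma> A (step K a \<Gamma>) = Some a'"
      and eq: "T = ETrunc i A" "t' = EIn i A' a'" "d = 0"
      by (auto simp: bind_eq_Some_conv)
    note A = has_sort_sound[OF EIn.IH(1)[OF EIn.prems] A]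
    note a = against_sound(1)[OF K EIn.prems EIn.IH(2)[OF EIn.prems] a]
    from red_In[OF A a] red_ty[OF a] eq
    show "good_result \<Gamma> (EIn i A a) T t' d"
      by (simp add: good_result_def parts_typed_def)
  qed
next
  case (ESquash i A a b)
  show ?case unfolding good_def
  proof (intro allI impI)
    fix T t' d assume "step K (ESquash i A a b) \<Gamma> = Some (T, t', d)"
    then obtain A' a' b' where A: "has_sort i (step K A \<Gamma>) = Some A'"
      and a: "against K \<Gamma> (ETrunc i A) (step K a \<Gamma>) = Some a'" and b: "against K \<Gamma> (ETrunc i A) (step K b \<Gamma>) = Some b'"
      and eq: "T = EId i (ETrunc i A) a b" "t' = ESquash i A' a' b'" "d = 0"
      by (auto simp: bind_eq_Some_conv)
    note A = has_sort_sound[OF ESquash.IH(1)[OF ESquash.prems] A]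
    note a = against_sound(1)[OF K ESquash.prems ESquash.IH(2)[OF ESquash.prems] a, simplified]
    note b = against_sound(1)[OF K ESquash.prems ESquash.IH(3)[OF ESquash.prems] b, simplified]
    from red_Squash[OF A a b] eq
    show "good_result \<Gamma> (ESquash i A a b) T t' d"
      by (simp add: good_result_def parts_typed_def)
  qed
next
  case (ETruncInd i k A C h g z)
  show ?case unfolding good_def
  proof (intro allI impI)
    fix T t' d assume "step K (ETruncInd i k A C h g z) \<Gamma> = Some (T, t', d)"
    then obtain A' C' h' g' z' where A: "has_sort i (step K A \<Gamma>) = Some A'"
      and C: "has_sort k (step K C (ETrunc i A # \<Gamma>)) = Some C'"
      and h: "against K \<Gamma> (EPi (ETrunc i A) (EPi C (EPi (up C) (EId k (xlift (Suc (Suc 0)) 0 C) (EVar (Suc 0)) (EVar 0))))) (step K h \<Gamma>) = Some h'"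
      and g: "against K (A # \<Gamma>) (xsubst 0 (EIn i (up A) (EVar 0)) (xlift (Suc 0) (Suc 0) C)) (step K g (A # \<Gamma>)) = Some g'"
      and z: "against K \<Gamma> (ETrunc i A) (step K z \<Gamma>) = Some z'"
      and eq: "T = xsubst 0 z C" "d = 0"
        "t' = (case z of EIn i' A2 x \<Rightarrow> if i' = i \<and> A2 = A then xsubst 0 x g' else ETruncInd i k A' C' h' g' z'
        | _ \<Rightarrow> ETruncInd i k A' C' h' g' z')"
      by (auto simp: bind_eq_Some_conv)
    note A = has_sort_sound[OF ETruncInd.IH(1)[OF ETruncInd.prems] A]
    have c: "(map embed (A # \<Gamma>)) ctx" using ctx_Cons red_ty[OF A] by auto
    note g = against_sound(1)[OF K c ETruncInd.IH(4)[OF c] g, simplified]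
    have c: "(map embed (ETrunc i A # \<Gamma>)) ctx" using ctx_Cons red_ty[OF red_Trunc[OF A]] by auto
    note C = has_sort_sound[OF ETruncInd.IH(2)[OF c] C, simplified]
    note h = against_sound(1)[OF K ETruncInd.prems ETruncInd.IH(3)[OF ETruncInd.prems] h, simplified]
    note z = against_sound[OF K ETruncInd.prems ETruncInd.IH(5)[OF ETruncInd.prems] z, simplified]
    note r = red_TruncInd[OF A C h g z(1)]
    have "red (map embed \<Gamma>) (embed (ETruncInd i k A C h g z)) (embed t') (embed T)"
    proof (cases "\<exists>x. z = EIn i A x")
      case True
      then obtain x where zq: "z = EIn i A x" by blast
      with z(2) r(2)[of "embed x"] eq show ?thesis by (simp add: good_result_def parts_typed_def)
    next
      case False
      then have "t' = ETruncInd i k A' C' h' g' z'" using eq(3) by (auto split: expr.splits)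
      with r(1) eq(1) show ?thesis by simp
    qed
    with eq(2) show "good_result \<Gamma> (ETruncInd i k A C h g z) T t' d"
      by (simp add: good_result_def parts_typed_def)
  qed
qed

lemma check_sound: "sound (check n)"
proof (induction n)
  case 0
  then show ?case by (simp add: sound_def good_def)
next
  case (Suc n)
  then show ?case using step_sound by (auto simp: sound_def)
qed

section \<open>Proof terms with hypotheses\<close>

text \<open>
  The context of hypotheses.  It is kept folded during evaluation, with an entry computed only when it is
  looked up: otherwise every rewrite step would traverse the types of all the hypotheses.
\<close>

definition assumed :: "pre list \<Rightarrow> expr list" where
  "assumed Ss = map (\<lambda>S. the (parse (close S) [])) Ss"

lemma entry_assumed:
  "entry (assumed (S # Ss)) 0 = Some (the (parse (close S) []))"
  "entry (assumed (S # Ss)) (Suc n) = entry (assumed Ss) n"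
  by (simp_all add: assumed_def)

text \<open>
  The hypotheses \<open>Ss\<close> are listed innermost first, so \<open>bvar 0\<close> in \<open>t\<close> refers to the last of them.
  The fuel three bounds how deeply reducing a type may call for reducing the types that occur inside it.
\<close>

definition verify :: "pre list \<Rightarrow> pre \<Rightarrow> pre \<Rightarrow> bool" where
  "verify Ss t T = (do {
     T \<leftarrow> parse (close T) []; t \<leftarrow> parse (t (length Ss)) [];
     k \<leftarrow> sort_of (step (check (Suc (Suc (Suc 0)))) T []);
     e \<leftarrow> against (check (Suc (Suc (Suc 0)))) (assumed Ss) T (step (check (Suc (Suc (Suc 0)))) t (assumed Ss));
     if up T = T then Some () else None } \<noteq> None)"

text \<open>
  A closed type that may serve as a hypothesis of later proof terms.  Besides being inhabited it has to
  be a well-formed type, because inhabitation alone is not shown to imply this.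
\<close>

definition proved :: "pre \<Rightarrow> bool" where
  "proved S \<longleftrightarrow> inhabited S \<and> (\<exists>k. [] \<turnstile> close S : Univ k) \<and> lift 0 (close S) = close S \<and>
     (\<exists>E. parse (close S) [] = Some E)"

lemma closed_liftn: "lift 0 t = t \<Longrightarrow> (lift 0 ^^ n) t = t"
  by (induction n) auto

lemma proved_ctx: "\<forall>S\<in>set Ss. proved S \<Longrightarrow> (map close Ss) ctx"
proof (induction Ss)
  case (Cons S Ss)
  then obtain k where c: "(map close Ss @ []) ctx" "[] \<turnstile> close S : Univ k" "lift 0 (close S) = close S"
    by (auto simp: proved_def)
  from weakening_ctx[OF c(1,2)] closed_liftn[OF c(3)] show ?case by (auto intro: ctx_Cons)
qed (simp add: ctx_Nil)

text \<open>
  Hypotheses that are inhabited can be substituted away.  The result is about the same type because \<open>T\<close>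
  has no free variables.
\<close>

lemma discharge:
  "\<forall>S\<in>set Ss. proved S \<Longrightarrow> map close Ss \<turnstile> t : T \<Longrightarrow> lift 0 T = T \<Longrightarrow> \<exists>t. [] \<turnstile> t : T"
proof (induction Ss arbitrary: t)
  case (Cons S Ss)
  then have c: "(map close Ss @ []) ctx" "lift 0 (close S) = close S" and "inhabited S"
    using proved_ctx[of Ss] by (auto simp: proved_def)
  then obtain s where "[] \<turnstile> s : close S" by (auto simp: inhabited_def)
  from weakening_ctx[OF c(1) this] closed_liftn[OF c(2)]
  have "map close Ss \<turnstile> (lift 0 ^^ length Ss) s : close S" by simp
  from substitution[OF this Cons.prems(2)[simplified]] Cons.prems(3)
  have "map close Ss \<turnstile> subst 0 ((lift 0 ^^ length Ss) s) t : T" by (metis subst_lift_cancel)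
  with Cons show ?case by auto
qed auto

lemma embed_assumed: "\<forall>S\<in>set Ss. proved S \<Longrightarrow> map embed (assumed Ss) = map close Ss"
  by (force simp: assumed_def proved_def dest: parse_sound)

theorem verified:
  assumes "verify Ss t T" and Ss: "\<forall>S\<in>set Ss. proved S"
  shows "proved T"
proof -
  from assms(1) obtain e E k E' e' where E: "parse (close T) [] = Some E" and e: "parse (t (length Ss)) [] = Some e"
    and k: "sort_of (step (check (Suc (Suc (Suc 0)))) E []) = Some (k, E')"
    and a: "against (check (Suc (Suc (Suc 0)))) (assumed Ss) E (step (check (Suc (Suc (Suc 0)))) e (assumed Ss)) = Some e'"
    and up: "up E = E"
    by (auto simp: verify_def bind_eq_Some_conv split: if_splits)
  have T: "embed E = close T" using parse_sound[OF E] by simp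
  have "lift 0 (close T) = close T" using arg_cong[OF up, of embed] T by simp
  moreover have c: "(map embed (assumed Ss)) ctx" using proved_ctx[OF Ss] embed_assumed[OF Ss] by simp
  from against_sound(1)[OF check_sound c step_sound[OF check_sound c] a]
  have "map close Ss \<turnstile> embed e : close T" using embed_assumed[OF Ss] T by (simp add: red_def)
  moreover have "[] \<turnstile> close T : Univ k"
    using red_ty[OF sort_of_sound[OF step_sound[OF check_sound] k]] T by (simp add: ctx_Nil)
  ultimately show ?thesis using discharge[OF Ss] E by (auto simp: proved_def inhabited_def)
qed

section \<open>Running the checker\<close>

lemma bind_weak_cong: "m = n \<Longrightarrow> Option.bind m f = Option.bind n f"
  by simp

lemma verify_cong: "verify Ss t T = verify Ss t T"
  and assumed_cong: "assumed Ss = assumed Ss"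
  and length_cong: "length Ss = length Ss"
  by (rule refl)+

lemma max_levels: "max (Suc n) n = Suc n" "max n (Suc n) = Suc n" "max n n = n"
  by auto

text \<open>
  The rules that run the checker by rewriting.  Universe levels are the only symbolic part of the terms
  below; apart from reflexivity, the equations for \<open>max\<close> are all that is needed to compute with them.
\<close>

lemmas evaluation =
  PI_def LAM_def app_def con_def univ_def bvar_def close_def closed_def Let_def
  transport_def path_inverse_def path_concat_def ap_def isProp_def isSet_def SET_def El_def
  isConnected_def iffT_def fam_def loopmap_def PointedLift_def
  verify_def parse.simps pcon.simps papp.simps lam_over_def dest_Lam.simps dest_Pi.simps dest_Univ.simps
  step.simps check.simps conv.simps expose_Pi.simps sort_of_def has_sort_def against_def steps_def
  xlift.simps xsubst.simps xsubst2_def entry.simps entry_assumed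
  expr.inject expr.distinct expr.case nat.inject nat.distinct nat.case option.inject option.distinct
  option.case option.sel list.case list.size prod.case prod.inject bind.bind_lunit bind.bind_lzero
  if_True if_False simp_thms not_less_zero Suc_less_eq zero_less_Suc n_not_Suc_n Suc_n_not_n
  add_0 add_Suc add_0_right add_Suc_right diff_Suc_Suc diff_0_eq_0 minus_nat.diff_0 One_nat_def max_levels

text \<open>Congruence rules that evaluate a scrutinee before any branch, and leave hypotheses folded.\<close>

lemmas evaluation_cong = bind_weak_cong option.case_cong_weak prod.case_cong_weak if_weak_cong
  list.case_cong_weak expr.case_cong_weak nat.case_cong_weak verify_cong assumed_cong length_cong

section \<open>Weakly constant maps into a set\<close>

abbreviation sigind where
  "sigind i j k A B C g z \<equiv> con (CSigInd i j k) \<cdot> A \<cdot> LAM A B \<cdot> LAM (SIG i j A B) C \<cdot> (\<Lambda> a\<in>A. \<Lambda> b\<in>B a. g a b) \<cdot> z"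

abbreviation fstT where
  "fstT i j A B z \<equiv> sigind i j i A B (\<lambda>_. A) (\<lambda>a b. a) z"

abbreviation sndT where
  "sndT i j A B z \<equiv> sigind i j j A B (\<lambda>z. B (fstT i j A B z)) (\<lambda>a b. b) z"

abbreviation truncind where
  "truncind i k A C h g z \<equiv> con (CTruncInd i k) \<cdot> A \<cdot> LAM (Trunc i A) C \<cdot> h \<cdot> LAM A g \<cdot> z"

abbreviation inT where
  "inT i A a \<equiv> con (CIn i) \<cdot> A \<cdot> a"

abbreviation squash where
  "squash i A a b \<equiv> con (CSquash i) \<cdot> A \<cdot> a \<cdot> b"

abbreviation preimage where
  "preimage i A B g v \<equiv> (\<Sigma>\<^bsub>i,i\<^esub> a\<in>A. IdT i B (g \<cdot> a) v)"

abbreviation inhabited_preimage where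
  "inhabited_preimage i A B g v \<equiv> Trunc i (preimage i A B g v)"

abbreviation image_of where
  "image_of i A B g \<equiv> (\<Sigma>\<^bsub>i,i\<^esub> v\<in>B. inhabited_preimage i A B g v)"

abbreviation image_point where
  "image_point i A B g v m \<equiv> pairT i i B (inhabited_preimage i A B g) v m"

text \<open>
  The parameters shared by the next types and by their proof terms: \<open>quant\<close> is \<open>PI\<close> for the former and
  \<open>LAM\<close> for the latter.
\<close>

abbreviation weakly_constant :: "(pre \<Rightarrow> (pre \<Rightarrow> pre) \<Rightarrow> pre) \<Rightarrow> nat \<Rightarrow> (pre \<Rightarrow> pre \<Rightarrow> pre \<Rightarrow> pre \<Rightarrow> pre \<Rightarrow> pre) \<Rightarrow> pre" where
  "weakly_constant quant i R \<equiv>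
     quant (\<U> i) (\<lambda>A. quant (\<U> i) (\<lambda>B. quant (isSet i \<cdot> B) (\<lambda>s. quant (A \<rightarrow> B) (\<lambda>g.
       quant (\<Pi> a\<in>A. \<Pi> b\<in>A. IdT i B (g \<cdot> a) (g \<cdot> b)) (\<lambda>h. R A B s g h)))))"

definition preimage_points_equal :: "nat \<Rightarrow> pre" where
  "preimage_points_equal i = weakly_constant PI i (\<lambda>A B s g h. \<Pi> v\<in>B. \<Pi> v'\<in>B.
     \<Pi> m\<in>preimage i A B g v. \<Pi> m'\<in>preimage i A B g v'. IdT i B v v')"

text \<open>The chain \<open>v = g a = g b = v'\<close>, composed by two path inductions.\<close>

lemma preimage_points_equal: "proved (preimage_points_equal i)"
proof (rule verified)
  show "verify []
    (weakly_constant LAM i (\<lambda>A B s g h. \<Lambda> v\<in>B. \<Lambda> v'\<in>B. \<Lambda> m\<in>preimage i A B g v. \<Lambda> m'\<in>preimage i A B g v'.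
       sigind i i i A (\<lambda>a. IdT i B (g \<cdot> a) v) (\<lambda>_. IdT i B v v') (\<lambda>a e.
         sigind i i i A (\<lambda>b. IdT i B (g \<cdot> b) v') (\<lambda>_. IdT i B v v') (\<lambda>b e'.
           idind i i B (g \<cdot> a) (\<lambda>x _. IdT i B x v')
             (idind i i B (g \<cdot> b) (\<lambda>x _. IdT i B (g \<cdot> a) x) (h \<cdot> a \<cdot> b) v' e') v e) m') m))
    (preimage_points_equal i)"
    by (simp only: preimage_points_equal_def evaluation cong: evaluation_cong)
qed simp

definition image_points_equal :: "nat \<Rightarrow> pre" where
  "image_points_equal i = weakly_constant PI i (\<lambda>A B s g h. \<Pi> v\<in>B. \<Pi> v'\<in>B.
     \<Pi> m\<in>inhabited_preimage i A B g v. \<Pi> m'\<in>inhabited_preimage i A B g v'. IdT i B v v')"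

text \<open>The truncations may be eliminated because the equations between points of a set are propositions.\<close>

lemma image_points_equal: "proved (image_points_equal i)"
proof (rule verified)
  show "verify [preimage_points_equal i]
    (let points_equal = bvar 0 in
     weakly_constant LAM i (\<lambda>A B s g h. \<Lambda> v\<in>B. \<Lambda> v'\<in>B.
       \<Lambda> m\<in>inhabited_preimage i A B g v. \<Lambda> m'\<in>inhabited_preimage i A B g v'.
         truncind i i (preimage i A B g v) (\<lambda>_. IdT i B v v') (\<Lambda> _\<in>inhabited_preimage i A B g v. s \<cdot> v \<cdot> v')
           (\<lambda>n. truncind i i (preimage i A B g v') (\<lambda>_. IdT i B v v') (\<Lambda> _\<in>inhabited_preimage i A B g v'. s \<cdot> v \<cdot> v')
              (\<lambda>n'. points_equal \<cdot> A \<cdot> B \<cdot> s \<cdot> g \<cdot> h \<cdot> v \<cdot> v' \<cdot> n \<cdot> n') m') m))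
    (image_points_equal i)"
    by (simp only: preimage_points_equal_def image_points_equal_def evaluation cong: evaluation_cong)
qed (simp add: preimage_points_equal)

definition image_isProp :: "nat \<Rightarrow> pre" where
  "image_isProp i = weakly_constant PI i (\<lambda>A B s g h.
     \<Pi> t\<in>image_of i A B g. \<Pi> t'\<in>image_of i A B g. IdT i (image_of i A B g) t t')"

text \<open>
  Two points of the image are equal once their values are: by induction on the equation of the values,
  only the elements of a truncation are left to compare.
\<close>

lemma image_isProp: "proved (image_isProp i)"
proof (rule verified)
  show "verify [image_points_equal i]
    (let values_equal = bvar 0 in
     weakly_constant LAM i (\<lambda>A B s g h. \<Lambda> t\<in>image_of i A B g. \<Lambda> t'\<in>image_of i A B g.
       sigind i i i B (inhabited_preimage i A B g) (\<lambda>t. IdT i (image_of i A B g) t t') (\<lambda>v m.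
         sigind i i i B (inhabited_preimage i A B g)
           (\<lambda>t'. IdT i (image_of i A B g) (image_point i A B g v m) t') (\<lambda>v' m'.
             idind i i B v
               (\<lambda>x _. \<Pi> m'\<in>inhabited_preimage i A B g x.
                  IdT i (image_of i A B g) (image_point i A B g v m) (image_point i A B g x m'))
               (\<Lambda> m'\<in>inhabited_preimage i A B g v.
                  idind i i (inhabited_preimage i A B g v) m
                    (\<lambda>m' _. IdT i (image_of i A B g) (image_point i A B g v m) (image_point i A B g v m'))
                    (reflT i (image_of i A B g) (image_point i A B g v m))
                    m' (squash i (preimage i A B g v) m m'))
               v' (values_equal \<cdot> A \<cdot> B \<cdot> s \<cdot> g \<cdot> h \<cdot> v \<cdot> v' \<cdot> m \<cdot> m') \<cdot> m') t') t))
    (image_isProp i)"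
    by (simp only: image_points_equal_def image_isProp_def evaluation cong: evaluation_cong)
qed (simp add: image_points_equal)

definition value_of_weakly_constant :: "nat \<Rightarrow> pre" where
  "value_of_weakly_constant i = weakly_constant PI i (\<lambda>A B s g h.
     \<Pi> z\<in>Trunc i A. \<Sigma>\<^bsub>i,i\<^esub> v\<in>B. \<Pi> a\<in>A. IdT i B v (g \<cdot> a))"

text \<open>
  The truncation of \<open>A\<close> maps to the image, since that is a proposition.  A point of the image has the required
  property: its value is \<open>g b\<close> for some \<open>b\<close>, up to truncation, and \<open>g b = g a\<close>.
\<close>

lemma value_of_weakly_constant: "proved (value_of_weakly_constant i)"
proof (rule verified)
  show "verify [image_isProp i]
    (let image_prop = bvar 0 in
     weakly_constant LAM i (\<lambda>A B s g h. \<Lambda> z\<in>Trunc i A.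
       sigind i i i B (inhabited_preimage i A B g) (\<lambda>_. \<Sigma>\<^bsub>i,i\<^esub> v\<in>B. \<Pi> a\<in>A. IdT i B v (g \<cdot> a))
         (\<lambda>v m. pairT i i B (\<lambda>v. \<Pi> a\<in>A. IdT i B v (g \<cdot> a)) v
            (\<Lambda> a\<in>A. truncind i i (preimage i A B g v) (\<lambda>_. IdT i B v (g \<cdot> a))
               (\<Lambda> _\<in>inhabited_preimage i A B g v. s \<cdot> v \<cdot> (g \<cdot> a))
               (\<lambda>n. sigind i i i A (\<lambda>b. IdT i B (g \<cdot> b) v) (\<lambda>_. IdT i B v (g \<cdot> a)) (\<lambda>b e.
                  idind i i B (g \<cdot> b) (\<lambda>x _. IdT i B x (g \<cdot> a)) (h \<cdot> b \<cdot> a) v e) n) m))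
         (truncind i i A (\<lambda>_. image_of i A B g) (\<Lambda> _\<in>Trunc i A. image_prop \<cdot> A \<cdot> B \<cdot> s \<cdot> g \<cdot> h)
            (\<lambda>a. image_point i A B g (g \<cdot> a)
               (inT i (preimage i A B g (g \<cdot> a))
                  (pairT i i A (\<lambda>b. IdT i B (g \<cdot> b) (g \<cdot> a)) a (reflT i B (g \<cdot> a))))) z)))
    (value_of_weakly_constant i)"
    by (simp only: image_isProp_def value_of_weakly_constant_def evaluation cong: evaluation_cong)
qed (simp add: image_isProp)

section \<open>Sections determined by paths from the base point\<close>

abbreviation loop_invariant :: "(pre \<Rightarrow> (pre \<Rightarrow> pre) \<Rightarrow> pre) \<Rightarrow> nat \<Rightarrow> (pre \<Rightarrow> pre \<Rightarrow> pre \<Rightarrow> pre \<Rightarrow> pre \<Rightarrow> pre) \<Rightarrow> pre" where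
  "loop_invariant quant i R \<equiv>
     quant (\<U> i) (\<lambda>Y. quant Y (\<lambda>y\<^sub>0. quant (Y \<rightarrow> \<U> i) (\<lambda>Q. quant (\<Pi> y\<in>Y. \<Pi> q\<in>IdT i Y y\<^sub>0 y. Q \<cdot> y) (\<lambda>G.
       quant (\<Pi> p\<in>IdT i Y y\<^sub>0 y\<^sub>0. IdT i (Q \<cdot> y\<^sub>0) (G \<cdot> y\<^sub>0 \<cdot> p) (G \<cdot> y\<^sub>0 \<cdot> reflT i Y y\<^sub>0)) (\<lambda>h. R Y y\<^sub>0 Q G h)))))"

definition paths_agree :: "nat \<Rightarrow> pre" where
  "paths_agree i = loop_invariant PI i (\<lambda>Y y\<^sub>0 Q G h.
     \<Pi> y\<in>Y. \<Pi> q\<in>IdT i Y y\<^sub>0 y. \<Pi> q'\<in>IdT i Y y\<^sub>0 y. IdT i (Q \<cdot> y) (G \<cdot> y \<cdot> q) (G \<cdot> y \<cdot> q'))"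

text \<open>When \<open>q'\<close> is reflexivity, \<open>q\<close> is a loop and the hypothesis on loops applies.\<close>

lemma paths_agree: "proved (paths_agree i)"
proof (rule verified)
  show "verify []
    (loop_invariant LAM i (\<lambda>Y y\<^sub>0 Q G h. \<Lambda> y\<in>Y. \<Lambda> q\<in>IdT i Y y\<^sub>0 y. \<Lambda> q'\<in>IdT i Y y\<^sub>0 y.
       idind i i Y y\<^sub>0 (\<lambda>y q'. \<Pi> q\<in>IdT i Y y\<^sub>0 y. IdT i (Q \<cdot> y) (G \<cdot> y \<cdot> q) (G \<cdot> y \<cdot> q')) h y q' \<cdot> q))
    (paths_agree i)"
    by (simp only: paths_agree_def evaluation cong: evaluation_cong)
qed simp

definition section_from_paths :: "nat \<Rightarrow> pre" where
  "section_from_paths i = loop_invariant PI i (\<lambda>Y y\<^sub>0 Q G h.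
     \<Pi> s\<in>(\<Pi> y\<in>Y. isSet i \<cdot> (Q \<cdot> y)). \<Pi> c\<in>isConnected i \<cdot> Y.
       \<Sigma>\<^bsub>i,i\<^esub> l\<in>(\<Pi> y\<in>Y. Q \<cdot> y). IdT i (Q \<cdot> y\<^sub>0) (l \<cdot> y\<^sub>0) (G \<cdot> y\<^sub>0 \<cdot> reflT i Y y\<^sub>0))"

text \<open>
  At \<open>y\<close> the section takes the value that belongs to the element \<open>c y\<^sub>0 y\<close> of the truncation of \<open>y\<^sub>0 = y\<close>.
  At \<open>y\<^sub>0\<close> this value equals \<open>G y\<^sub>0 q\<close> for every \<open>q\<close>, in particular for reflexivity.
\<close>

lemma section_from_paths: "proved (section_from_paths i)"
proof (rule verified)
  show "verify [paths_agree i, value_of_weakly_constant i]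
    (let common_value = bvar 0; agree = bvar (Suc 0) in
     loop_invariant LAM i (\<lambda>Y y\<^sub>0 Q G h. \<Lambda> s\<in>(\<Pi> y\<in>Y. isSet i \<cdot> (Q \<cdot> y)). \<Lambda> c\<in>isConnected i \<cdot> Y.
       let V = (\<lambda>y v. \<Pi> q\<in>IdT i Y y\<^sub>0 y. IdT i (Q \<cdot> y) v (G \<cdot> y \<cdot> q));
           E = (\<lambda>y. common_value \<cdot> IdT i Y y\<^sub>0 y \<cdot> (Q \<cdot> y) \<cdot> (s \<cdot> y) \<cdot> (G \<cdot> y) \<cdot> (agree \<cdot> Y \<cdot> y\<^sub>0 \<cdot> Q \<cdot> G \<cdot> h \<cdot> y)
                 \<cdot> (c \<cdot> y\<^sub>0 \<cdot> y))
       in pairT i i (\<Pi> y\<in>Y. Q \<cdot> y) (\<lambda>l. IdT i (Q \<cdot> y\<^sub>0) (l \<cdot> y\<^sub>0) (G \<cdot> y\<^sub>0 \<cdot> reflT i Y y\<^sub>0))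
            (\<Lambda> y\<in>Y. fstT i i (Q \<cdot> y) (V y) (E y))
            (sndT i i (Q \<cdot> y\<^sub>0) (V y\<^sub>0) (E y\<^sub>0) \<cdot> reflT i Y y\<^sub>0)))
    (section_from_paths i)"
    by (simp only: value_of_weakly_constant_def paths_agree_def section_from_paths_def evaluation cong: evaluation_cong)
qed (simp add: value_of_weakly_constant paths_agree)

section \<open>The lifting criterion for a family of types\<close>

text \<open>
  Transport, inverse, concatenation and the action on paths, unfolded to path inductions.  Both
  directions are proved for the unfolded operations, whose terms are smaller and compute directly.
\<close>

abbreviation transp where
  "transp i X P a b p u \<equiv> idind i i X a (\<lambda>x _. P \<cdot> x) u b p"

abbreviation path_inv where
  "path_inv i X a b p \<equiv> idind i i X a (\<lambda>x _. IdT i X x a) (reflT i X a) b p"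

abbreviation path_comp where
  "path_comp i X a b c p q \<equiv> idind i i X b (\<lambda>x _. IdT i X a x) p c q"

abbreviation ap_path where
  "ap_path i Y X f a b p \<equiv> idind i i Y a (\<lambda>x _. IdT i X (f \<cdot> a) (f \<cdot> x)) (reflT i X (f \<cdot> a)) b p"

abbreviation image_loop where
  "image_loop i X Y y\<^sub>0 f x w p \<equiv>
     path_comp i X x (f \<cdot> y\<^sub>0) x
       (path_comp i X x (f \<cdot> y\<^sub>0) (f \<cdot> y\<^sub>0) (path_inv i X (f \<cdot> y\<^sub>0) x w) (ap_path i Y X f y\<^sub>0 y\<^sub>0 p)) w"

abbreviation fixed_by where
  "fixed_by i X P Y y\<^sub>0 f x w u p \<equiv> IdT i (P \<cdot> x) (transp i X P x x (image_loop i X Y y\<^sub>0 f x w p) u) u"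

abbreviation based_lift where
  "based_lift i X P Y y\<^sub>0 f x w u \<equiv>
     (\<Sigma>\<^bsub>i,i\<^esub> l\<in>(\<Pi> y\<in>Y. P \<cdot> (f \<cdot> y)). IdT i (P \<cdot> x) (transp i X P (f \<cdot> y\<^sub>0) x w (l \<cdot> y\<^sub>0)) u)"

text \<open>
  Transport of \<open>u\<close> along \<open>refl \<cdot> ap f q\<close>.  The leading reflexivity is what \<open>image_loop\<close> leaves when \<open>w\<close> is
  reflexivity; with it the two agree judgmentally.
\<close>

abbreviation transp_along where
  "transp_along i X P Y y\<^sub>0 f y q u \<equiv>
     transp i X P (f \<cdot> y\<^sub>0) (f \<cdot> y)
       (path_comp i X (f \<cdot> y\<^sub>0) (f \<cdot> y\<^sub>0) (f \<cdot> y) (reflT i X (f \<cdot> y\<^sub>0)) (ap_path i Y X f y\<^sub>0 y q)) u"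

abbreviation over_family :: "(pre \<Rightarrow> (pre \<Rightarrow> pre) \<Rightarrow> pre) \<Rightarrow> nat \<Rightarrow> (pre \<Rightarrow> pre \<Rightarrow> pre \<Rightarrow> pre \<Rightarrow> pre \<Rightarrow> pre) \<Rightarrow> pre" where
  "over_family quant i R \<equiv>
     quant (\<U> i) (\<lambda>X. quant (X \<rightarrow> \<U> i) (\<lambda>P. quant (\<U> i) (\<lambda>Y. quant Y (\<lambda>y\<^sub>0. quant (Y \<rightarrow> X) (\<lambda>f. R X P Y y\<^sub>0 f)))))"

definition lift_fixes_loops :: "nat \<Rightarrow> pre" where
  "lift_fixes_loops i = over_family PI i (\<lambda>X P Y y\<^sub>0 f.
     \<Pi> x\<in>X. \<Pi> w\<in>IdT i X (f \<cdot> y\<^sub>0) x. \<Pi> u\<in>P \<cdot> x. \<Pi> l\<in>(\<Pi> y\<in>Y. P \<cdot> (f \<cdot> y)).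
     \<Pi> e\<in>IdT i (P \<cdot> x) (transp i X P (f \<cdot> y\<^sub>0) x w (l \<cdot> y\<^sub>0)) u. \<Pi> p\<in>IdT i Y y\<^sub>0 y\<^sub>0.
       fixed_by i X P Y y\<^sub>0 f x w u p)"

text \<open>
  Inductions on \<open>e\<close>, on \<open>w\<close> and finally on \<open>p\<close>; for the last one the claim is generalized to paths with a
  free endpoint \<open>y\<close>, where it says that \<open>l y\<^sub>0\<close> is transported to \<open>l y\<close>.
\<close>

lemma lift_fixes_loops: "proved (lift_fixes_loops i)"
proof (rule verified)
  show "verify []
    (over_family LAM i (\<lambda>X P Y y\<^sub>0 f.
       \<Lambda> x\<in>X. \<Lambda> w\<in>IdT i X (f \<cdot> y\<^sub>0) x. \<Lambda> u\<in>P \<cdot> x. \<Lambda> l\<in>(\<Pi> y\<in>Y. P \<cdot> (f \<cdot> y)).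
       \<Lambda> e\<in>IdT i (P \<cdot> x) (transp i X P (f \<cdot> y\<^sub>0) x w (l \<cdot> y\<^sub>0)) u. \<Lambda> p\<in>IdT i Y y\<^sub>0 y\<^sub>0.
         idind i i (P \<cdot> x) (transp i X P (f \<cdot> y\<^sub>0) x w (l \<cdot> y\<^sub>0)) (\<lambda>u _. fixed_by i X P Y y\<^sub>0 f x w u p)
           (idind i i X (f \<cdot> y\<^sub>0) (\<lambda>x w. fixed_by i X P Y y\<^sub>0 f x w (transp i X P (f \<cdot> y\<^sub>0) x w (l \<cdot> y\<^sub>0)) p)
              (idind i i Y y\<^sub>0
                 (\<lambda>y r. IdT i (P \<cdot> (f \<cdot> y)) (transp_along i X P Y y\<^sub>0 f y r (l \<cdot> y\<^sub>0)) (l \<cdot> y))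
                 (reflT i (P \<cdot> (f \<cdot> y\<^sub>0)) (l \<cdot> y\<^sub>0)) y\<^sub>0 p)
              x w)
           u e))
    (lift_fixes_loops i)"
    by (simp only: lift_fixes_loops_def evaluation cong: evaluation_cong)
qed simp

definition lift_from_fixing_loops :: "nat \<Rightarrow> pre" where
  "lift_from_fixing_loops i = over_family PI i (\<lambda>X P Y y\<^sub>0 f.
     \<Pi> s\<in>(\<Pi> x\<in>X. isSet i \<cdot> (P \<cdot> x)). \<Pi> c\<in>isConnected i \<cdot> Y.
     \<Pi> x\<in>X. \<Pi> w\<in>IdT i X (f \<cdot> y\<^sub>0) x. \<Pi> u\<in>P \<cdot> x.
     \<Pi> h\<in>(\<Pi> p\<in>IdT i Y y\<^sub>0 y\<^sub>0. fixed_by i X P Y y\<^sub>0 f x w u p). based_lift i X P Y y\<^sub>0 f x w u)"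

text \<open>
  By induction on \<open>w\<close>, with \<open>u\<close> and the hypothesis on loops generalized because their types mention \<open>x\<close>.
\<close>

lemma lift_from_fixing_loops: "proved (lift_from_fixing_loops i)"
proof (rule verified)
  show "verify [section_from_paths i]
    (let sec = bvar 0 in
     over_family LAM i (\<lambda>X P Y y\<^sub>0 f.
       \<Lambda> s\<in>(\<Pi> x\<in>X. isSet i \<cdot> (P \<cdot> x)). \<Lambda> c\<in>isConnected i \<cdot> Y. \<Lambda> x\<in>X. \<Lambda> w\<in>IdT i X (f \<cdot> y\<^sub>0) x.
         idind i i X (f \<cdot> y\<^sub>0)
           (\<lambda>x w. \<Pi> u\<in>P \<cdot> x. \<Pi> h\<in>(\<Pi> p\<in>IdT i Y y\<^sub>0 y\<^sub>0. fixed_by i X P Y y\<^sub>0 f x w u p). based_lift i X P Y y\<^sub>0 f x w u)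
           (\<Lambda> u\<in>P \<cdot> (f \<cdot> y\<^sub>0).
            \<Lambda> h\<in>(\<Pi> p\<in>IdT i Y y\<^sub>0 y\<^sub>0. fixed_by i X P Y y\<^sub>0 f (f \<cdot> y\<^sub>0) (reflT i X (f \<cdot> y\<^sub>0)) u p).
              sec \<cdot> Y \<cdot> y\<^sub>0 \<cdot> (\<Lambda> y\<in>Y. P \<cdot> (f \<cdot> y))
                \<cdot> (\<Lambda> y\<in>Y. \<Lambda> q\<in>IdT i Y y\<^sub>0 y. transp_along i X P Y y\<^sub>0 f y q u) \<cdot> h \<cdot> (\<Lambda> y\<in>Y. s \<cdot> (f \<cdot> y)) \<cdot> c)
           x w))
    (lift_from_fixing_loops i)"
    by (simp only: section_from_paths_def lift_from_fixing_loops_def evaluation cong: evaluation_cong)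
qed (simp add: section_from_paths)

abbreviation lifts where
  "lifts i X P Y y\<^sub>0 f x w u \<equiv>
     (\<Sigma>\<^bsub>i,i\<^esub> l\<in>(\<Pi> y\<in>Y. P \<cdot> (f \<cdot> y)). IdT i (P \<cdot> x) (transport i i \<cdot> X \<cdot> P \<cdot> (f \<cdot> y\<^sub>0) \<cdot> x \<cdot> w \<cdot> (l \<cdot> y\<^sub>0)) u)"

abbreviation loops_fix where
  "loops_fix i X P Y y\<^sub>0 f x w u \<equiv>
     (\<Pi> p\<in>IdT i Y y\<^sub>0 y\<^sub>0.
        IdT i (P \<cdot> x) (transport i i \<cdot> X \<cdot> P \<cdot> x \<cdot> x \<cdot> (loopmap i \<cdot> X \<cdot> x \<cdot> Y \<cdot> y\<^sub>0 \<cdot> f \<cdot> w \<cdot> p) \<cdot> u) u)"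

definition lifting_criterion :: "nat \<Rightarrow> pre" where
  "lifting_criterion i = over_family PI i (\<lambda>X P Y y\<^sub>0 f.
     \<Pi> s\<in>(\<Pi> x\<in>X. isSet i \<cdot> (P \<cdot> x)). \<Pi> c\<in>isConnected i \<cdot> Y.
     \<Pi> x\<in>X. \<Pi> w\<in>IdT i X (f \<cdot> y\<^sub>0) x. \<Pi> u\<in>P \<cdot> x.
       iffT i \<cdot> lifts i X P Y y\<^sub>0 f x w u \<cdot> loops_fix i X P Y y\<^sub>0 f x w u)"

text \<open>
  Passing from the unfolded operations to the defined ones.  It is done here, for a variable family \<open>P\<close>, because
  unfolding them for the family of a covering space gives much larger terms.
\<close>

lemma lifting_criterion: "proved (lifting_criterion i)"
proof (rule verified)
  show "verify [lift_from_fixing_loops i, lift_fixes_loops i]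
    (let fixes_loops = bvar 0; from_loops = bvar (Suc 0) in
     over_family LAM i (\<lambda>X P Y y\<^sub>0 f.
       \<Lambda> s\<in>(\<Pi> x\<in>X. isSet i \<cdot> (P \<cdot> x)). \<Lambda> c\<in>isConnected i \<cdot> Y.
       \<Lambda> x\<in>X. \<Lambda> w\<in>IdT i X (f \<cdot> y\<^sub>0) x. \<Lambda> u\<in>P \<cdot> x.
         let L = lifts i X P Y y\<^sub>0 f x w u; M = loops_fix i X P Y y\<^sub>0 f x w u in
         pairT i i (L \<rightarrow> M) (\<lambda>_. M \<rightarrow> L)
           (\<Lambda> z\<in>L. sigind i i i (\<Pi> y\<in>Y. P \<cdot> (f \<cdot> y))
              (\<lambda>l. IdT i (P \<cdot> x) (transp i X P (f \<cdot> y\<^sub>0) x w (l \<cdot> y\<^sub>0)) u) (\<lambda>_. M)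
              (\<lambda>l e. fixes_loops \<cdot> X \<cdot> P \<cdot> Y \<cdot> y\<^sub>0 \<cdot> f \<cdot> x \<cdot> w \<cdot> u \<cdot> l \<cdot> e) z)
           (\<Lambda> m\<in>M. from_loops \<cdot> X \<cdot> P \<cdot> Y \<cdot> y\<^sub>0 \<cdot> f \<cdot> s \<cdot> c \<cdot> x \<cdot> w \<cdot> u \<cdot> m)))
    (lifting_criterion i)"
    by (simp only: lift_from_fixing_loops_def lift_fixes_loops_def lifting_criterion_def evaluation cong: evaluation_cong)
qed (simp add: lift_from_fixing_loops lift_fixes_loops)

section \<open>Covering spaces\<close>

definition fibres_are_sets :: "nat \<Rightarrow> pre" where
  "fibres_are_sets i = (\<Pi> X\<in>\<U> i. \<Pi> F\<in>(X \<rightarrow> SET i). \<Pi> x\<in>X. isSet i \<cdot> (fam i \<cdot> X \<cdot> F \<cdot> x))"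

text \<open>The second projection from \<open>SET\<close>, applied to \<open>F x\<close>.\<close>

lemma fibres_are_sets: "proved (fibres_are_sets i)"
proof (rule verified)
  show "verify []
    (\<Lambda> X\<in>\<U> i. \<Lambda> F\<in>(X \<rightarrow> SET i). \<Lambda> x\<in>X.
       sigind (Suc i) i i (\<U> i) (\<lambda>A. isSet i \<cdot> A) (\<lambda>S. isSet i \<cdot> (El i \<cdot> S)) (\<lambda>A h. h) (F \<cdot> x))
    (fibres_are_sets i)"
    by (simp only: fibres_are_sets_def evaluation cong: evaluation_cong)
qed simp

theorem theorem8:
  fixes i :: nat
  shows "inhabited (
    \<Pi> X\<in>\<U> i. \<Pi> x\<^sub>0\<in>X. \<Pi> F\<in>(X \<rightarrow> SET i). \<Pi> u\<^sub>0\<in>fam i \<cdot> X \<cdot> F \<cdot> x\<^sub>0.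
    \<Pi> Y\<in>\<U> i. \<Pi> y\<^sub>0\<in>Y. \<Pi> f\<in>(Y \<rightarrow> X). \<Pi> w\<in>IdT i X (f \<cdot> y\<^sub>0) x\<^sub>0. \<Pi> c\<in>isConnected i \<cdot> Y.
      iffT i
        \<cdot> (PointedLift i \<cdot> X \<cdot> x\<^sub>0 \<cdot> F \<cdot> u\<^sub>0 \<cdot> Y \<cdot> y\<^sub>0 \<cdot> f \<cdot> w)
        \<cdot> (\<Pi> p\<in>IdT i Y y\<^sub>0 y\<^sub>0.
            IdT i (fam i \<cdot> X \<cdot> F \<cdot> x\<^sub>0)
              (transport i i \<cdot> X \<cdot> (fam i \<cdot> X \<cdot> F) \<cdot> x\<^sub>0 \<cdot> x\<^sub>0
                \<cdot> (loopmap i \<cdot> X \<cdot> x\<^sub>0 \<cdot> Y \<cdot> y\<^sub>0 \<cdot> f \<cdot> w \<cdot> p) \<cdot> u\<^sub>0)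
              u\<^sub>0))"
proof -
  let "inhabited ?T" = ?thesis
  \<comment> \<open>With the family \<open>fam X F\<close>, one unfolding of \<open>PointedLift\<close> gives the pairs that the criterion speaks of.\<close>
  have "proved ?T"
  proof (rule verified)
    show "verify [lifting_criterion i, fibres_are_sets i]
      (let sets = bvar 0; criterion = bvar (Suc 0) in
       \<Lambda> X\<in>\<U> i. \<Lambda> x\<^sub>0\<in>X. \<Lambda> F\<in>(X \<rightarrow> SET i). \<Lambda> u\<^sub>0\<in>fam i \<cdot> X \<cdot> F \<cdot> x\<^sub>0.
       \<Lambda> Y\<in>\<U> i. \<Lambda> y\<^sub>0\<in>Y. \<Lambda> f\<in>(Y \<rightarrow> X). \<Lambda> w\<in>IdT i X (f \<cdot> y\<^sub>0) x\<^sub>0. \<Lambda> c\<in>isConnected i \<cdot> Y.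
         criterion \<cdot> X \<cdot> (fam i \<cdot> X \<cdot> F) \<cdot> Y \<cdot> y\<^sub>0 \<cdot> f \<cdot> (sets \<cdot> X \<cdot> F) \<cdot> c \<cdot> x\<^sub>0 \<cdot> w \<cdot> u\<^sub>0)
      ?T"
      by (simp only: fibres_are_sets_def lifting_criterion_def evaluation cong: evaluation_cong)
  qed (simp add: fibres_are_sets lifting_criterion)
  then show ?thesis by (simp add: proved_def)
qed

end
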